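(* Let $G=(V,E)$ be a connected, undirected, simple graph that is not a cycle, and let $n_M$ be the total number of vertices lying in maximal $2$-edge-connected components of $G$. Then every pebble permutation instance $(G,S,\Pi)$ with $p\le n_M-3$ pebbles is feasible.
   Context: A maximal 2-edge-connected component of $G$ is a subgraph with at least two vertices that stays connected after deleting any single edge and is not contained in any larger such subgraph of $G$. Pebbles are labeled $1,\dots,p$. A configuration is an injective map $S:\{1,\dots,p\}\to V$, written $S=\langle s_1,\dots,s_p\rangle$. A move is a pair of configurations differing at exactly one pebble $i$, with $(s_i,s_i')\in E$. Two configurations are connected if one is obtained from the other by a finite sequence of moves. A pebble permutation instance $(G,S,\Pi)$, with $\Pi$ a permutation of $\{1,\dots,p\}$, is feasible if $S$ is connected to the configuration $D$ with $d_i=s_{\Pi(i)}$ for all $i$. *)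

theory Defs
  imports "Graph_Theory.Digraph_Component" "HOL-Combinatorics.Permutations" "HOL-Library.FuncSet"
begin

text \<open>
  A finite simple undirected graph is a \<^const>\<open>pair_graph\<close>: an edge between \<open>u\<close> and \<open>v\<close> is
  the pair of opposite arcs \<open>(u, v)\<close> and \<open>(v, u)\<close>, so deleting an edge removes both.
\<close>

definition delete_edge :: "'a pair_pre_digraph \<Rightarrow> 'a \<Rightarrow> 'a \<Rightarrow> 'a pair_pre_digraph" where
  "delete_edge G u v = \<lparr> pverts = pverts G, parcs = parcs G - {(u, v), (v, u)} \<rparr>"

text \<open>
  Length at least three rules out the closed walk \<open>u, v, u\<close>, which \<^const>\<open>pre_digraph.cycle\<close>
  accepts in a symmetric digraph.
\<close>

definition is_cycle_graph :: "'a pair_pre_digraph \<Rightarrow> bool" where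
  "is_cycle_graph G \<longleftrightarrow>
    (\<exists>c. pre_digraph.cycle (with_proj G) c \<and> 3 \<le> length c \<and>
         pverts G = fst ` set c \<and> parcs G = set c \<union> (set c)\<inverse>)"

definition two_edge_connected :: "'a pair_pre_digraph \<Rightarrow> bool" where
  "two_edge_connected H \<longleftrightarrow>
    2 \<le> card (pverts H) \<and> Digraph_Component.connected (with_proj H) \<and>
    (\<forall>(u, v) \<in> parcs H. Digraph_Component.connected (with_proj (delete_edge H u v)))"

definition max_two_edge_connected_component ::
    "'a pair_pre_digraph \<Rightarrow> 'a pair_pre_digraph \<Rightarrow> bool" where
  "max_two_edge_connected_component G H \<longleftrightarrow>
    pair_graph H \<and> subgraph (with_proj H) (with_proj G) \<and> two_edge_connected H \<and>
    (\<forall>H'. pair_graph H' \<and> subgraph (with_proj H') (with_proj G) \<and> two_edge_connected H' \<and>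
          subgraph (with_proj H) (with_proj H') \<longrightarrow> H' = H)"

definition n_M :: "'a pair_pre_digraph \<Rightarrow> nat" where
  "n_M G = card (\<Union>H \<in> {H. max_two_edge_connected_component G H}. pverts H)"

definition configuration :: "'a pair_pre_digraph \<Rightarrow> nat \<Rightarrow> (nat \<Rightarrow> 'a) \<Rightarrow> bool" where
  "configuration G p S \<longleftrightarrow> S \<in> {1..p} \<rightarrow>\<^sub>E pverts G \<and> inj_on S {1..p}"

definition pebble_move ::
    "'a pair_pre_digraph \<Rightarrow> nat \<Rightarrow> (nat \<Rightarrow> 'a) \<Rightarrow> (nat \<Rightarrow> 'a) \<Rightarrow> bool" where
  "pebble_move G p S S' \<longleftrightarrow>
    configuration G p S \<and> configuration G p S' \<and>
    (\<exists>i. {j \<in> {1..p}. S j \<noteq> S' j} = {i} \<and> (S i, S' i) \<in> parcs G)"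

definition config_connected ::
    "'a pair_pre_digraph \<Rightarrow> nat \<Rightarrow> (nat \<Rightarrow> 'a) \<Rightarrow> (nat \<Rightarrow> 'a) \<Rightarrow> bool" where
  "config_connected G p = (pebble_move G p)\<^sup>*\<^sup>*"

definition pebble_permutation_instance ::
    "'a pair_pre_digraph \<Rightarrow> nat \<Rightarrow> (nat \<Rightarrow> 'a) \<Rightarrow> (nat \<Rightarrow> nat) \<Rightarrow> bool" where
  "pebble_permutation_instance G p S \<pi> \<longleftrightarrow> configuration G p S \<and> \<pi> permutes {1..p}"

definition feasible ::
    "'a pair_pre_digraph \<Rightarrow> nat \<Rightarrow> (nat \<Rightarrow> 'a) \<Rightarrow> (nat \<Rightarrow> nat) \<Rightarrow> bool" where
  "feasible G p S \<pi> \<longleftrightarrow> config_connected G p S (\<lambda>i \<in> {1..p}. S (\<pi> i))"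

end

theory Submission
  imports Defs "HOL-Library.Transitive_Closure_Table"
begin

text \<open>
  Call two pebbles exchangeable in a configuration if the configuration with just these two swapped
  can be reached. This is an equivalence relation on pebbles, it is invariant under moves, and it
  suffices to show that all pebbles are equivalent. On a cycle with one pendant edge, two holes make
  all pebbles equivalent: rotate until two neighbouring pebbles meet the junction and swap them
  there. Sets of vertices on which three holes make all pebbles equivalent can be enlarged cycle by
  cycle, because the holes can be parked in an overlap together with a common pebble, or next to a
  bridge over which a pebble is carried.

  The vertices of the maximal 2-edge-connected components lie on cycles. Let \<open>M\<close> be the set of
  vertices on cycles. First move all pebbles into \<open>M\<close>, where at least three holes remain. As the
  other vertices are now empty, they can be contracted: a pebble passes between two vertices of \<open>M\<close>
  along any path whose interior avoids \<open>M\<close>. The enlargement argument applies to the contracted graph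
  unless one cycle fills \<open>M\<close>. Such a cycle has a pendant edge or a chord, since the graph is not a
  cycle, and a chord splits it into two smaller cycles.
\<close>

section \<open>Sliding pebbles\<close>

definition slide :: "'b set \<Rightarrow> 'a rel \<Rightarrow> ('b \<Rightarrow> 'a) \<Rightarrow> ('b \<Rightarrow> 'a) \<Rightarrow> bool" where
  "slide I E S S' \<longleftrightarrow> (\<exists>i\<in>I. \<exists>v. (S i, v) \<in> E \<and> v \<notin> S ` I \<and> S' = S(i := v))"

definition reaches :: "'b set \<Rightarrow> 'a rel \<Rightarrow> ('b \<Rightarrow> 'a) \<Rightarrow> ('b \<Rightarrow> 'a) \<Rightarrow> bool" where
  "reaches I E = (slide I E)\<^sup>*\<^sup>*"

lemma slideI: "i \<in> I \<Longrightarrow> (S i, v) \<in> E \<Longrightarrow> v \<notin> S ` I \<Longrightarrow> slide I E S (S(i := v))"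
  unfolding slide_def by blast

lemma slideE:
  assumes "slide I E S S'"
  obtains i v where "i \<in> I" "(S i, v) \<in> E" "v \<notin> S ` I" "S' = S(i := v)"
  using assms unfolding slide_def by blast

lemma slide_inj_on: "slide I E S S' \<Longrightarrow> inj_on S I \<Longrightarrow> inj_on S' I"
  by (auto elim!: slideE intro: inj_on_fun_updI)

lemma image_fun_upd_inj_on:
  assumes "inj_on S I" "i \<in> I"
  shows "(S(i := v)) ` I = insert v (S ` I - {S i})"
  using assms by (auto simp: inj_on_def)

lemma slide_sym:
  assumes "sym E" "inj_on S I" "slide I E S S'"
  shows "slide I E S' S"
proof -
  obtain i v where i: "i \<in> I" "(S i, v) \<in> E" "v \<notin> S ` I" "S' = S(i := v)"
    using assms(3) by (rule slideE)
  have "(S' i, S i) \<in> E" using i \<open>sym E\<close> by (auto dest: symD)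
  moreover have "S i \<notin> S' ` I" using i image_fun_upd_inj_on[OF assms(2) i(1)] by auto
  ultimately have "slide I E S' (S'(i := S i))" by (rule slideI[OF i(1)])
  then show ?thesis using i(4) by simp
qed

lemma slide_comp_permutes:
  assumes "\<pi> permutes I" "slide I E S S'"
  shows "slide I E (S \<circ> \<pi>) (S' \<circ> \<pi>)"
proof -
  obtain i v where i: "i \<in> I" "(S i, v) \<in> E" "v \<notin> S ` I" "S' = S(i := v)"
    using assms(2) by (rule slideE)
  let ?j = "inv \<pi> i"
  have j: "?j \<in> I" "\<pi> ?j = i"
    using assms(1) i(1) by (simp_all add: permutes_inverses permutes_in_image[OF permutes_inv])
  have "v \<notin> (S \<circ> \<pi>) ` I" using i(3) permutes_image[OF assms(1)] by (metis image_comp)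
  then have "slide I E (S \<circ> \<pi>) ((S \<circ> \<pi>)(?j := v))" using i(2) j by (intro slideI) simp_all
  moreover have "S' \<circ> \<pi> = (S \<circ> \<pi>)(?j := v)"
    using i(4) j(2) permutes_inverses(2)[OF assms(1)] by (auto simp: fun_eq_iff)
  ultimately show ?thesis by simp
qed

lemma reaches_refl [simp]: "reaches I E S S"
  unfolding reaches_def by simp

lemma reaches_trans [trans]: "reaches I E S S' \<Longrightarrow> reaches I E S' S'' \<Longrightarrow> reaches I E S S''"
  unfolding reaches_def by simp

lemma slide_reaches: "slide I E S S' \<Longrightarrow> reaches I E S S'"
  unfolding reaches_def by simp

lemma reaches_induct [consumes 1, case_names refl slide]:
  assumes "reaches I E S S'" "P S"
    and "\<And>S1 S2. reaches I E S S1 \<Longrightarrow> slide I E S1 S2 \<Longrightarrow> P S1 \<Longrightarrow> P S2"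
  shows "P S'"
  using assms(1) unfolding reaches_def
  by (induction rule: rtranclp_induct) (auto simp: reaches_def[symmetric] intro: assms(2,3))

lemma reaches_inj_on: "reaches I E S S' \<Longrightarrow> inj_on S I \<Longrightarrow> inj_on S' I"
  by (induction rule: reaches_induct) (auto intro: slide_inj_on)

lemma reaches_sym:
  assumes "sym E" "inj_on S I" "reaches I E S S'"
  shows "reaches I E S' S"
  using assms(3)
proof (induction rule: reaches_induct)
  case (slide S1 S2)
  have "slide I E S2 S1"
    using slide_sym[OF assms(1)] reaches_inj_on[OF slide(1) assms(2)] slide(2) by blast
  then show ?case using slide(3) by (meson slide_reaches reaches_trans)
qed simp

lemma reaches_comp_permutes:
  assumes "\<pi> permutes I" "reaches I E S S'"
  shows "reaches I E (S \<circ> \<pi>) (S' \<circ> \<pi>)"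
  using assms(2)
proof (induction rule: reaches_induct)
  case (slide S1 S2)
  then show ?case using slide_comp_permutes[OF assms(1)] by (meson slide_reaches reaches_trans)
qed simp

lemma reaches_mono: "E \<subseteq> F \<Longrightarrow> reaches I E S S' \<Longrightarrow> reaches I F S S'"
  unfolding reaches_def
  by (erule rtranclp_mono[THEN predicate2D, rotated]) (fastforce simp: slide_def)

lemma reaches_outside_index: "reaches I E S S' \<Longrightarrow> i \<notin> I \<Longrightarrow> S' i = S i"
  by (induction rule: reaches_induct) (auto elim!: slideE)

lemma reaches_Restr: "reaches I (Restr E K) S S' \<Longrightarrow> reaches I E S S'"
  by (rule reaches_mono) auto

lemma reaches_Restr_mem_iff: "reaches I (Restr E K) S S' \<Longrightarrow> S' i \<in> K \<longleftrightarrow> S i \<in> K"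
  by (induction rule: reaches_induct) (auto elim!: slideE split: if_splits)

lemma reaches_Restr_outside: "reaches I (Restr E K) S S' \<Longrightarrow> S i \<notin> K \<Longrightarrow> S' i = S i"
  by (induction rule: reaches_induct) (auto elim!: slideE split: if_splits)

lemma reaches_Restr_image_Diff:
  assumes "reaches I (Restr E K) S S'"
  shows "S' ` I - K = S ` I - K"
proof -
  have "S' ` I - K = S' ` {i\<in>I. S i \<notin> K}" using reaches_Restr_mem_iff[OF assms] by auto
  also have "\<dots> = S ` {i\<in>I. S i \<notin> K}"
    by (rule image_cong) (simp_all add: reaches_Restr_outside[OF assms])
  also have "\<dots> = S ` I - K" by auto
  finally show ?thesis .
qed

lemma reaches_Restr_vacant:
  assumes "reaches I (Restr E K) S S'" "w \<notin> K" "w \<notin> S ` I"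
  shows "w \<notin> S' ` I"
  using reaches_Restr_image_Diff[OF assms(1)] assms(2,3) by blast

lemma sym_Restr: "sym E \<Longrightarrow> sym (Restr E K)"
  by (auto simp: sym_def)

lemma slide_into_hole:
  assumes "inj_on S I" "u \<in> S ` I" "v \<notin> S ` I" "(u, v) \<in> E"
  obtains S' where "slide I E S S'" "S' ` I = insert v (S ` I - {u})"
proof -
  obtain i where i: "i \<in> I" "u = S i" using assms(2) by blast
  show thesis
  proof
    show "slide I E S (S(i := v))" using i assms(3,4) by (intro slideI) simp_all
    show "(S(i := v)) ` I = insert v (S ` I - {u})"
      using image_fun_upd_inj_on[OF assms(1) i(1)] i(2) by simp
  qed
qed

lemma reaches_transfer_hole:
  assumes "(t, u) \<in> E\<^sup>*" "sym E" "inj_on S I" "t \<notin> S ` I" "u \<in> S ` I"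
  shows "\<exists>S'. reaches I E S S' \<and> S' ` I = insert t (S ` I - {u})"
  using assms(1,3-)
proof (induction arbitrary: S rule: rtrancl_induct)
  case base
  then show ?case by blast
next
  case (step y u)
  have uy: "(u, y) \<in> E" using step(2) \<open>sym E\<close> by (auto dest: symD)
  show ?case
  proof (cases "y \<in> S ` I")
    case True
    obtain S1 where S1: "reaches I E S S1" "S1 ` I = insert t (S ` I - {y})"
      using step.IH[OF step.prems(1,2) True] by blast
    show ?thesis
    proof (cases "y = u")
      case False
      then have "u \<in> S1 ` I" "y \<notin> S1 ` I" using S1(2) True step.prems by auto
      then obtain S2 where "slide I E S1 S2" "S2 ` I = insert y (S1 ` I - {u})"
        using slide_into_hole[OF reaches_inj_on[OF S1(1) step.prems(1)] _ _ uy] by blast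
      moreover from this have "S2 ` I = insert t (S ` I - {u})"
        using S1(2) True False step.prems by auto
      ultimately show ?thesis using S1(1) by (meson slide_reaches reaches_trans)
    qed (use S1 in blast)
  next
    case False
    obtain S1 where S1: "slide I E S S1" "S1 ` I = insert y (S ` I - {u})"
      using slide_into_hole[OF step.prems(1,3) False uy] .
    show ?thesis
    proof (cases "y = t")
      case True
      then show ?thesis using S1 slide_reaches by blast
    next
      case ne: False
      then obtain S2 where "reaches I E S1 S2" "S2 ` I = insert t (S1 ` I - {y})"
        using step.IH[OF slide_inj_on[OF S1(1) step.prems(1)]] S1(2) step.prems by auto
      moreover from this have "S2 ` I = insert t (S ` I - {u})" using S1(2) False by auto
      ultimately show ?thesis using S1(1) by (meson slide_reaches reaches_trans)
    qed
  qed
qed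

lemma reaches_vacated:
  assumes "inj_on S I" "u \<notin> S ` I" "u \<noteq> v" "(v, u) \<in> E"
  shows "\<exists>S'. reaches I (Restr E {u, v}) S S' \<and> (\<forall>i\<in>I. S' i = (if S i = v then u else S i))"
proof (cases "v \<in> S ` I")
  case True
  then obtain j where j: "j \<in> I" "S j = v" by blast
  have "slide I (Restr E {u, v}) S (S(j := u))"
    using j assms(2,4) by (intro slideI) simp_all
  moreover have "(S(j := u)) i = (if S i = v then u else S i)" if "i \<in> I" for i
    using that j assms(1) by (auto dest: inj_onD)
  ultimately show ?thesis using slide_reaches by blast
next
  case False
  then show ?thesis by (intro exI[of _ S]) auto
qed

lemma reaches_shift_path:
  fixes f :: "nat \<Rightarrow> 'a"
  assumes "inj_on S I" "inj_on f {..n}" "\<And>l. l < n \<Longrightarrow> (f (Suc l), f l) \<in> E" "f 0 \<notin> S ` I"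
  shows "\<exists>S'. reaches I (Restr E (f ` {..n})) S S' \<and> f n \<notin> S' ` I \<and>
    (\<forall>i\<in>I. \<forall>l<n. S i = f (Suc l) \<longrightarrow> S' i = f l)"
  using assms
proof (induction n arbitrary: f S)
  case 0
  then show ?case by (intro exI[of _ S]) auto
next
  case (Suc n)
  let ?E = "Restr E (f ` {..Suc n})" and ?g = "\<lambda>l. f (Suc l)"
  have f_eq_iff: "f k = f l \<longleftrightarrow> k = l" if "k \<le> Suc n" "l \<le> Suc n" for k l
    using inj_on_eq_iff[OF Suc.prems(2)] that by simp
  obtain S1 where S1: "reaches I (Restr E {f 0, ?g 0}) S S1"
      and vacated: "\<And>i. i \<in> I \<Longrightarrow> S1 i = (if S i = ?g 0 then f 0 else S i)"
    using reaches_vacated[OF Suc.prems(1,4), of "?g 0" E] Suc.prems(3)[of 0] f_eq_iff by auto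
  have "?g 0 \<notin> S1 ` I" using vacated f_eq_iff by auto
  moreover have "inj_on ?g {..n}" using f_eq_iff by (intro inj_onI) simp
  ultimately obtain S' where S': "reaches I (Restr E (?g ` {..n})) S1 S'" "?g n \<notin> S' ` I"
      and shifted: "\<And>i l. i \<in> I \<Longrightarrow> l < n \<Longrightarrow> S1 i = ?g (Suc l) \<Longrightarrow> S' i = ?g l"
    using Suc.IH[OF reaches_inj_on[OF S1 Suc.prems(1)], of ?g] Suc.prems(3) by auto
  have "reaches I ?E S S1" by (rule reaches_mono[OF _ S1]) auto
  also have "reaches I ?E S1 S'" by (rule reaches_mono[OF _ S'(1)]) auto
  finally have "reaches I ?E S S'" .
  moreover have "S' i = f l" if "i \<in> I" "l < Suc n" "S i = f (Suc l)" for i l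
  proof (cases l)
    case 0
    then have "S1 i = f 0" using vacated that by simp
    moreover have "f 0 \<notin> ?g ` {..n}" using f_eq_iff by auto
    ultimately show ?thesis using reaches_Restr_outside[OF S'(1), of i] 0 by simp
  next
    case (Suc k)
    then have "S1 i = ?g (Suc k)" using vacated that f_eq_iff by simp
    then show ?thesis using shifted that Suc by simp
  qed
  ultimately show ?case using S'(2) by blast
qed

section \<open>Rearranging holes\<close>

definition connected_in :: "'a rel \<Rightarrow> 'a set \<Rightarrow> bool" where
  "connected_in E K \<longleftrightarrow> (\<forall>x\<in>K. \<forall>y\<in>K. (x, y) \<in> (Restr E K)\<^sup>*)"

lemma connected_in_Un:
  assumes "sym E" "connected_in E K" "connected_in E L" "x \<in> K" "y \<in> L" "x = y \<or> (x, y) \<in> E"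
  shows "connected_in E (K \<union> L)"
proof -
  let ?R = "Restr E (K \<union> L)"
  have mono: "(Restr E K)\<^sup>* \<subseteq> ?R\<^sup>*" "(Restr E L)\<^sup>* \<subseteq> ?R\<^sup>*" by (rule rtrancl_mono, blast)+
  have xy: "(x, y) \<in> ?R\<^sup>*" using assms(4-6) by blast
  have from_x: "(x, k) \<in> ?R\<^sup>*" if "k \<in> K \<union> L" for k
  proof (cases "k \<in> K")
    case True
    then show ?thesis using assms(2,4) mono unfolding connected_in_def by blast
  next
    case False
    then have "(y, k) \<in> ?R\<^sup>*" using that assms(3,5) mono unfolding connected_in_def by blast
    then show ?thesis using xy by simp
  qed
  have "sym (?R\<^sup>*)" using assms(1) by (simp add: sym_Restr sym_rtrancl)
  then show ?thesis unfolding connected_in_def using from_x by (meson rtrancl_trans symD)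
qed

lemma connected_in_insert:
  assumes "sym E" "connected_in E K" "x \<in> K" "(x, w) \<in> E"
  shows "connected_in E (insert w K)"
  using connected_in_Un[OF assms(1,2), of "{w}" x w] assms(3,4) by (auto simp: connected_in_def)

lemma connected_in_boundary:
  assumes "connected_in E K" "A \<subset> K" "A \<noteq> {}"
  obtains x y where "x \<in> A" "y \<in> K - A" "(x, y) \<in> E"
proof -
  obtain a b where ab: "a \<in> A" "b \<in> K" "b \<notin> A" using assms by blast
  then have "(a, b) \<in> (Restr E K)\<^sup>*" using assms unfolding connected_in_def by blast
  then have "\<exists>x y. x \<in> A \<and> y \<in> K - A \<and> (x, y) \<in> E" using ab(1,3)
    by (induction rule: converse_rtrancl_induct) auto
  then show thesis using that by blast
qed

lemma connected_in_induct:
  assumes "finite V" "connected_in E V" "K \<subseteq> V" "K \<noteq> {}" "P K"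
    and enlarge: "\<And>K x v. P K \<Longrightarrow> K \<subseteq> V \<Longrightarrow> x \<in> K \<Longrightarrow> v \<in> V - K \<Longrightarrow> (x, v) \<in> E \<Longrightarrow>
      \<exists>K'. P K' \<and> K \<subset> K' \<and> K' \<subseteq> V"
  shows "P V"
  using assms(3-5)
proof (induction "card (V - K)" arbitrary: K rule: less_induct)
  case less
  show ?case
  proof (cases "K = V")
    case False
    then obtain x v where "x \<in> K" "v \<in> V - K" "(x, v) \<in> E"
      using connected_in_boundary[OF assms(2), of K] less.prems by blast
    then obtain K' where K': "P K'" "K \<subset> K'" "K' \<subseteq> V" using enlarge less.prems by meson
    have "card (V - K') < card (V - K)"
      using K'(2,3) \<open>finite V\<close> by (intro psubset_card_mono) auto
    then show ?thesis using less.hyps[of K'] K' by blast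
  qed (use less.prems in simp)
qed

lemma reaches_occupied:
  assumes "sym E" "connected_in E K" "finite K" "inj_on S I" "T \<subseteq> K" "card T = card (K \<inter> S ` I)"
  shows "\<exists>S'. reaches I (Restr E K) S S' \<and> K \<inter> S' ` I = T"
  using assms(4,6)
proof (induction "card (T - S ` I)" arbitrary: S rule: less_induct)
  case less
  have finT: "finite T" using assms(3,5) finite_subset by blast
  show ?case
  proof (cases "T \<subseteq> S ` I")
    case True
    then have "T \<subseteq> K \<inter> S ` I" using assms(5) by auto
    then have "K \<inter> S ` I = T" using less.prems(2) assms(3) by (metis card_subset_eq finite_Int)
    then show ?thesis by (intro exI[of _ S]) auto
  next
    case False
    then obtain t where t: "t \<in> T" "t \<notin> S ` I" by auto
    then have "\<not> K \<inter> S ` I \<subseteq> T" using less.prems(2) finT by (metis IntD2 card_subset_eq)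
    then obtain u where u: "u \<in> K" "u \<in> S ` I" "u \<notin> T" by auto
    have "(t, u) \<in> (Restr E K)\<^sup>*" using assms(2,5) t(1) u(1) unfolding connected_in_def by blast
    then obtain S1 where S1: "reaches I (Restr E K) S S1" "S1 ` I = insert t (S ` I - {u})"
      using reaches_transfer_hole[OF _ sym_Restr[OF assms(1)] less.prems(1)] t(2) u(2) by blast
    have "K \<inter> S1 ` I = insert t ((K \<inter> S ` I) - {u})" using S1(2) t(1) assms(5) by auto
    moreover have "card (K \<inter> S ` I) > 0" using u assms(3) by (auto simp: card_gt_0_iff)
    ultimately have "card T = card (K \<inter> S1 ` I)" using t(2) u less.prems(2) assms(3) by simp
    moreover have "T - S1 ` I \<subset> T - S ` I" using S1(2) t u(3) by auto
    then have "card (T - S1 ` I) < card (T - S ` I)" using finT by (intro psubset_card_mono) auto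
    ultimately obtain S' where "reaches I (Restr E K) S1 S'" "K \<inter> S' ` I = T"
      using less.hyps[of S1] reaches_inj_on[OF S1(1) less.prems(1)] by blast
    then show ?thesis using S1(1) reaches_trans by blast
  qed
qed

lemma reaches_rearranged:
  assumes "sym E" "connected_in E K" "finite K" "inj_on S I"
    and "A \<subseteq> K" "B \<subseteq> K" "A \<inter> B = {}" "card A \<le> card (K - S ` I)" "card B \<le> card (K \<inter> S ` I)"
  obtains S' where "reaches I (Restr E K) S S'" "A \<inter> S' ` I = {}" "B \<subseteq> S' ` I"
proof -
  have "finite A" using assms(3,5) finite_subset by blast
  moreover have "card K = card (K \<inter> S ` I) + card (K - S ` I)"
    using card_Int_Diff[OF assms(3)] .
  ultimately have "card (K \<inter> S ` I) \<le> card (K - A)"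
    using assms(5,8) by (simp add: card_Diff_subset)
  moreover have "B \<subseteq> K - A" using assms(6,7) by blast
  ultimately have "\<exists>T. B \<subseteq> T \<and> T \<subseteq> K - A \<and> card T = card (K \<inter> S ` I)"
    by (rule exists_subset_between[OF assms(9) _ _ finite_Diff[OF assms(3)]])
  then obtain T where T: "B \<subseteq> T" "T \<subseteq> K - A" "card T = card (K \<inter> S ` I)" by blast
  then have "T \<subseteq> K" by blast
  then obtain S' where "reaches I (Restr E K) S S'" "K \<inter> S' ` I = T"
    using reaches_occupied[OF assms(1-4) _ T(3)] by blast
  then show thesis using that T(1,2) assms(5) by blast
qed

lemma reaches_into:
  assumes "sym E" "connected_in E V" "finite V" "inj_on S I" "S ` I \<subseteq> V"
    and "M \<subseteq> V" "card I \<le> card M"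
  obtains S' where "reaches I E S S'" "S' ` I \<subseteq> M"
proof -
  have "card (V \<inter> S ` I) \<le> card M"
    using assms(4,5,7) by (simp add: Int_absorb1 card_image)
  then obtain T where T: "T \<subseteq> M" "card T = card (V \<inter> S ` I)"
    by (meson obtain_subset_with_card_n)
  then obtain S' where S': "reaches I (Restr E V) S S'" "V \<inter> S' ` I = T"
    using reaches_occupied[OF assms(1-4), of T] assms(6) by blast
  have "S' ` I \<subseteq> V" using reaches_Restr_image_Diff[OF S'(1)] assms(5) by blast
  then have "S' ` I \<subseteq> M" using S'(2) T(1) by blast
  then show thesis by (rule that[OF reaches_Restr[OF S'(1)]])
qed

section \<open>Exchangeable pebbles\<close>

definition exchangeable :: "'b set \<Rightarrow> 'a rel \<Rightarrow> ('b \<Rightarrow> 'a) \<Rightarrow> 'b \<Rightarrow> 'b \<Rightarrow> bool" where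
  "exchangeable I E S i j \<longleftrightarrow> reaches I E S (S \<circ> transpose i j)"

lemma exchangeable_refl [simp]: "exchangeable I E S i i"
  unfolding exchangeable_def by simp

lemma exchangeable_sym: "exchangeable I E S i j \<Longrightarrow> exchangeable I E S j i"
  unfolding exchangeable_def by (simp add: transpose_commute)

lemma exchangeable_trans:
  assumes "i \<in> I" "j \<in> I" "k \<in> I" "exchangeable I E S i j" "exchangeable I E S j k"
  shows "exchangeable I E S i k"
proof (cases "i = k \<or> j = k")
  case True
  then show ?thesis using assms by auto
next
  case False
  let ?a = "transpose i j" and ?b = "transpose j k"
  have perm: "?a permutes I" "?b permutes I" using assms(1-3) by (auto intro: permutes_swap_id)
  have "reaches I E S (S \<circ> ?a)" using assms(4) unfolding exchangeable_def .
  also have "reaches I E (S \<circ> ?a) (S \<circ> ?b \<circ> ?a)"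
    using reaches_comp_permutes[OF perm(1)] assms(5) unfolding exchangeable_def .
  also have "reaches I E (S \<circ> ?b \<circ> ?a) (S \<circ> ?a \<circ> ?b \<circ> ?a)"
    using reaches_comp_permutes[OF permutes_compose[OF perm], of E S "S \<circ> ?a"] assms(4)
    unfolding exchangeable_def by (simp add: comp_assoc)
  also have "S \<circ> ?a \<circ> ?b \<circ> ?a = S \<circ> (?a \<circ> ?b \<circ> ?a)" by (simp only: comp_assoc)
  also have "?a \<circ> ?b \<circ> ?a = transpose i k" using False by (simp add: transpose_comp_triple)
  finally show ?thesis unfolding exchangeable_def .
qed

lemma exchangeable_reaches:
  assumes "sym E" "inj_on S I" "reaches I E S S'" "i \<in> I" "j \<in> I" "exchangeable I E S' i j"
  shows "exchangeable I E S i j"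
proof -
  have "transpose i j permutes I" using assms(4,5) by (rule permutes_swap_id)
  then have "reaches I E (S' \<circ> transpose i j) (S \<circ> transpose i j)"
    using reaches_comp_permutes reaches_sym[OF assms(1-3)] by blast
  then show ?thesis using assms(3,6) unfolding exchangeable_def by (meson reaches_trans)
qed

lemma reaches_permuted:
  assumes "finite I" "\<And>i j. i \<in> I \<Longrightarrow> j \<in> I \<Longrightarrow> exchangeable I E S i j" "\<pi> permutes I"
  shows "reaches I E S (S \<circ> \<pi>)"
  using assms(3,1)
proof (induction rule: permutes_induct)
  case (swap a b p)
  have "reaches I E (S \<circ> p) (S \<circ> transpose a b \<circ> p)"
    using reaches_comp_permutes[OF swap(4)] assms(2)[OF swap(1,2)] unfolding exchangeable_def .
  moreover have "reaches I E S (S \<circ> p)" using swap.IH swap.prems .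
  ultimately show ?case unfolding comp_assoc by (rule reaches_trans[rotated])
qed simp

lemma reaches_star:
  assumes "inj_on S I" "i \<in> I" "j \<in> I" "i \<noteq> j" "(S i, b) \<in> E" "(S j, S i) \<in> E" "(S i, d) \<in> E"
    and "b \<notin> S ` I" "d \<notin> S ` I" "b \<noteq> d"
  shows "reaches I E S (S(i := b, j := d))"
proof -
  let ?S1 = "S(i := b)" and ?S2 = "S(i := b, j := S i)"
  have "\<forall>k\<in>I. k \<noteq> i \<longrightarrow> S k \<noteq> S i" "S i \<noteq> b" "S i \<noteq> d"
    using assms(1,2,8,9) by (auto dest: inj_onD)
  then have "\<forall>k\<in>I. ?S1 k \<noteq> S i" "\<forall>k\<in>I. ?S2 k \<noteq> d" using assms(9,10) by auto
  then have "S i \<notin> ?S1 ` I" "d \<notin> ?S2 ` I" by (metis imageE)+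
  then have "slide I E ?S1 ?S2" "slide I E ?S2 (?S2(j := d))"
    using assms(3,4,6,7) slideI[of j I ?S1 "S i" E] slideI[of j I ?S2 d E] by simp_all
  moreover have "slide I E S ?S1" using assms(2,5,8) by (rule slideI)
  ultimately show ?thesis by (metis (full_types) fun_upd_upd slide_reaches reaches_trans)
qed

text \<open>
  Once one pebble is on \<open>b\<close> and the other on \<open>d\<close>, it no longer matters which of them
  was at the centre.
\<close>

lemma exchangeable_star:
  assumes "sym E" "inj_on S I" "i \<in> I" "j \<in> I" "i \<noteq> j"
    and "(S i, S j) \<in> E" "(S i, b) \<in> E" "(S i, d) \<in> E" "b \<notin> S ` I" "d \<notin> S ` I" "b \<noteq> d"
  shows "exchangeable I E S i j"
proof -
  let ?T = "S(i := b, j := d)" and ?S = "S \<circ> transpose i j"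
  have sym_edges: "(S j, S i) \<in> E" "(b, S i) \<in> E" "(d, S i) \<in> E"
    using assms(6-8) \<open>sym E\<close> by (auto dest: symD)
  have perm: "transpose i j permutes I" using assms(3,4) by (rule permutes_swap_id)
  have im: "?S ` I = S ` I" using permutes_image[OF perm] by (metis image_comp)
  have inj: "inj_on ?S I"
    using assms(2) perm by (simp add: comp_inj_on permutes_image permutes_inj_on)
  have "reaches I E ?S (?S(j := d, i := b))"
    by (rule reaches_star[OF inj assms(4,3)]) (use assms im sym_edges in auto)
  also have "?S(j := d, i := b) = ?T" using assms(5) by (auto simp: fun_eq_iff transpose_def)
  finally have "reaches I E ?T ?S" using reaches_sym[OF assms(1) inj] by blast
  moreover have "reaches I E S ?T" using assms sym_edges by (intro reaches_star) auto
  ultimately show ?thesis unfolding exchangeable_def by (meson reaches_trans)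
qed

section \<open>Cycles\<close>

text \<open>A cycle of length \<open>m\<close> is a sequence of period \<open>m\<close>: rotating it shifts the index.\<close>

definition cycle_walk :: "'a rel \<Rightarrow> int \<Rightarrow> (int \<Rightarrow> 'a) \<Rightarrow> bool" where
  "cycle_walk E m z \<longleftrightarrow>
    3 \<le> m \<and> (\<forall>i j. z i = z j \<longleftrightarrow> m dvd i - j) \<and> (\<forall>i. (z i, z (i + 1)) \<in> E)"

lemma
  assumes "cycle_walk E m z"
  shows cycle_walk_length: "3 \<le> m"
    and cycle_walk_eq_iff: "z i = z j \<longleftrightarrow> m dvd i - j"
    and cycle_walk_edge: "(z i, z (i + 1)) \<in> E"
  using assms unfolding cycle_walk_def by auto

lemma cycle_walk_periodic: "cycle_walk E m z \<Longrightarrow> z (i + m) = z i"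
  by (simp add: cycle_walk_eq_iff)

lemma cycle_walk_shift:
  assumes "cycle_walk E m z"
  shows "cycle_walk E m (\<lambda>i. z (i + h))"
proof -
  have "(z (i + h), z (i + 1 + h)) \<in> E" for i
    using cycle_walk_edge[OF assms, of "i + h"] by (simp add: ac_simps)
  then show ?thesis using assms unfolding cycle_walk_def by simp
qed

lemma range_shift:
  fixes z :: "int \<Rightarrow> 'a"
  shows "range (\<lambda>i. z (i + h)) = range z"
proof -
  have "z i = z (i - h + h)" for i by simp
  then show ?thesis by blast
qed

lemma cycle_walk_inj_on:
  assumes "cycle_walk E m z" "b < a + m"
  shows "inj_on z {a..b}"
proof (rule linorder_inj_onI')
  fix i j assume ij: "i \<in> {a..b}" "j \<in> {a..b}" "i < j"
  then have "\<not> m dvd j - i" using assms(2) zdvd_not_zless[of "j - i" m] by simp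
  then show "z i \<noteq> z j" using cycle_walk_eq_iff[OF assms(1)] by metis
qed

lemma cycle_walk_indexE:
  assumes "cycle_walk E m z" "x \<in> range z"
  obtains i where "a \<le> i" "i < a + m" "x = z i"
proof -
  obtain k where "x = z k" using assms(2) by blast
  moreover have "m dvd k - (a + (k - a) mod m)"
    using dvd_minus_mod[of m "k - a"] by (simp add: algebra_simps)
  ultimately have "x = z (a + (k - a) mod m)" using cycle_walk_eq_iff[OF assms(1)] by simp
  then show thesis using that[of "a + (k - a) mod m"] cycle_walk_length[OF assms(1)] by simp
qed

lemma range_cycle_walk:
  assumes "cycle_walk E m z"
  shows "range z = z ` {a..a + m - 1}"
proof
  show "range z \<subseteq> z ` {a..a + m - 1}"
  proof
    fix x assume "x \<in> range z"
    then obtain i where "a \<le> i" "i < a + m" "x = z i" using cycle_walk_indexE[OF assms] by blast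
    then show "x \<in> z ` {a..a + m - 1}" by simp
  qed
qed auto

lemma finite_range_cycle_walk: "cycle_walk E m z \<Longrightarrow> finite (range z)"
  by (simp add: range_cycle_walk[where a = 0])

lemma card_range_cycle_walk: "cycle_walk E m z \<Longrightarrow> card (range z) = nat m"
  by (simp add: range_cycle_walk[where a = 0] card_image cycle_walk_inj_on)

lemma connected_in_range_cycle_walk:
  assumes "sym E" "cycle_walk E m z"
  shows "connected_in E (range z)"
proof -
  let ?R = "Restr E (range z)"
  have forward: "(z i, z (i + int n)) \<in> ?R\<^sup>*" for i n
  proof (induction n)
    case (Suc n)
    have "(z (i + int n), z (i + int n + 1)) \<in> ?R" using cycle_walk_edge[OF assms(2)] by auto
    with Suc have "(z i, z (i + int n + 1)) \<in> ?R\<^sup>*" by (rule rtrancl_into_rtrancl)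
    then show ?case by (simp add: ac_simps)
  qed simp
  have "sym (?R\<^sup>*)" using assms(1) by (intro sym_rtrancl sym_Restr)
  then have "(z i, z j) \<in> ?R\<^sup>*" for i j
    using forward[of i "nat (j - i)"] forward[of j "nat (i - j)"]
    by (cases "i \<le> j") (auto dest: symD)
  then show ?thesis unfolding connected_in_def by blast
qed

definition cycle_set :: "'a rel \<Rightarrow> 'a set \<Rightarrow> bool" where
  "cycle_set E C \<longleftrightarrow> (\<exists>m z. cycle_walk E m z \<and> C = range z)"

lemma finite_cycle_set: "cycle_set E C \<Longrightarrow> finite C"
  unfolding cycle_set_def by (auto simp: finite_range_cycle_walk)

lemma card_cycle_set: "cycle_set E C \<Longrightarrow> 3 \<le> card C"
  unfolding cycle_set_def by (fastforce simp: card_range_cycle_walk dest: cycle_walk_length)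

lemma connected_in_cycle_set: "sym E \<Longrightarrow> cycle_set E C \<Longrightarrow> connected_in E C"
  unfolding cycle_set_def by (auto simp: connected_in_range_cycle_walk)

lemma cycle_set_startE:
  assumes "cycle_set E C" "x \<in> C"
  obtains m z where "cycle_walk E m z" "C = range z" "x = z 0"
proof -
  obtain m z a where z: "cycle_walk E m z" "C = range z" "x = z a"
    using assms unfolding cycle_set_def by blast
  show thesis
    by (rule that[OF cycle_walk_shift[OF z(1), of a]]) (simp_all add: range_shift z)
qed

section \<open>Cycles with a pendant edge\<close>

lemma reaches_shift_arc:
  assumes "cycle_walk E m z" "sym E" "inj_on S I" "z h \<notin> S ` I" "h \<le> g" "g < h + m"
  obtains S' where "reaches I (Restr E (z ` {h..g})) S S'" "z g \<notin> S' ` I"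
    "\<And>i k. i \<in> I \<Longrightarrow> S i = z k \<Longrightarrow> h < k \<Longrightarrow> k \<le> g \<Longrightarrow> S' i = z (k - 1)"
proof -
  define n where "n = nat (g - h)"
  let ?f = "\<lambda>l. z (h + int l)"
  have g: "h + int n = g" using assms(5) by (simp add: n_def)
  have "inj_on ?f {..n}"
    using inj_onD[OF cycle_walk_inj_on[OF assms(1,6)]] g by (intro inj_onI) force
  moreover have "(?f (Suc l), ?f l) \<in> E" for l
    using cycle_walk_edge[OF assms(1), of "h + int l"] symD[OF assms(2)] by (simp add: ac_simps)
  ultimately obtain S' where S': "reaches I (Restr E (?f ` {..n})) S S'" "?f n \<notin> S' ` I"
    and shifted: "\<And>i l. i \<in> I \<Longrightarrow> l < n \<Longrightarrow> S i = ?f (Suc l) \<Longrightarrow> S' i = ?f l"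
    using reaches_shift_path[OF assms(3), of ?f n E] assms(4) by auto
  show thesis
  proof
    have "?f ` {..n} \<subseteq> z ` {h..g}" using g by auto
    then show "reaches I (Restr E (z ` {h..g})) S S'"
      by (intro reaches_mono[OF _ S'(1)]) blast
    show "z g \<notin> S' ` I" using S'(2) g by simp
    show "S' i = z (k - 1)" if "i \<in> I" "S i = z k" "h < k" "k \<le> g" for i k
      using shifted[OF that(1), of "nat (k - h - 1)"] that g by simp
  qed
qed

lemma reaches_rotate:
  assumes "cycle_walk E m z" "sym E" "inj_on S I" "z h \<notin> S ` I"
  obtains S' where "reaches I (Restr E (range z)) S S'" "z (h - 1) \<notin> S' ` I"
    "\<And>i k. i \<in> I \<Longrightarrow> S i = z k \<Longrightarrow> S' i = z (k - 1)"
proof -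
  have bounds: "h \<le> h + m - 1" "h + m - 1 < h + m"
    using cycle_walk_length[OF assms(1)] by simp_all
  obtain S' where S': "reaches I (Restr E (z ` {h..h + m - 1})) S S'" "z (h + m - 1) \<notin> S' ` I"
      and shifted: "\<And>i k. i \<in> I \<Longrightarrow> S i = z k \<Longrightarrow> h < k \<Longrightarrow> k \<le> h + m - 1 \<Longrightarrow> S' i = z (k - 1)"
    by (rule reaches_shift_arc[OF assms bounds]) (rule that)
  show thesis
  proof
    show "reaches I (Restr E (range z)) S S'"
      using S'(1) range_cycle_walk[OF assms(1), of h] by simp
    have "z (h + m - 1) = z (h - 1)" using cycle_walk_eq_iff[OF assms(1)] by simp
    then show "z (h - 1) \<notin> S' ` I" using S'(2) by simp
    show "S' i = z (k - 1)" if "i \<in> I" "S i = z k" for i k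
    proof -
      obtain j where j: "h \<le> j" "j < h + m" "z k = z j"
        using cycle_walk_indexE[OF assms(1), of "z k" h] by blast
      have "j \<noteq> h" using j(3) that assms(4) by (metis imageI)
      then have "S' i = z (j - 1)" using shifted[OF that(1)] that(2) j by simp
      also have "\<dots> = z (k - 1)"
        using j(3) cycle_walk_eq_iff[OF assms(1)] by (simp add: dvd_diff_commute)
      finally show ?thesis .
    qed
  qed
qed

lemma reaches_vacant_before:
  assumes "cycle_walk E m z" "sym E" "inj_on S I" "z h \<notin> S ` I" "z 0 \<in> S ` I" "z 1 \<in> S ` I"
  obtains S' where "reaches I (Restr E (range z)) S S'" "z (-1) \<notin> S' ` I"
    "\<And>k. S k \<in> {z 0, z 1} \<Longrightarrow> S' k = S k"
proof -
  obtain g where g: "0 \<le> g" "g < m" "z h = z g"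
    using cycle_walk_indexE[OF assms(1), of "z h" 0] by auto
  have "g \<noteq> 0" "g \<noteq> 1" using g(3) assms(4-6) by metis+
  then have "2 \<le> g" using g(1) by linarith
  have bounds: "z g \<notin> S ` I" "g \<le> m - 1" "m - 1 < g + m" using assms(4) g by simp_all
  obtain S' where S': "reaches I (Restr E (z ` {g..m - 1})) S S'" "z (m - 1) \<notin> S' ` I"
    by (rule reaches_shift_arc[OF assms(1-3) bounds]) (rule that)
  show thesis
  proof
    show "reaches I (Restr E (range z)) S S'" by (rule reaches_mono[OF _ S'(1)]) auto
    show "z (-1) \<notin> S' ` I" using S'(2) cycle_walk_periodic[OF assms(1), of "-1"] by simp
    have "z c \<notin> z ` {g..m - 1}" if "c \<in> {0, 1}" for c
      using inj_on_image_mem_iff[OF cycle_walk_inj_on[OF assms(1)], of "m - 1" 0 c "{g..m - 1}"]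
        that g \<open>2 \<le> g\<close> by auto
    then show "S' k = S k" if "S k \<in> {z 0, z 1}" for k
      using reaches_Restr_outside[OF S'(1)] that by auto
  qed
qed

locale lollipop =
  fixes E :: "'a rel" and m :: int and z :: "int \<Rightarrow> 'a" and w :: 'a
  assumes symE: "sym E"
    and cycle: "cycle_walk E m z"
    and pendant: "w \<notin> range z" "(z 0, w) \<in> E"
begin

lemma exchangeable_at_junction:
  assumes "inj_on S I" "w \<notin> S ` I" "z h \<notin> S ` I" "i \<in> I" "j \<in> I" "S i = z 0" "S j = z 1"
  shows "exchangeable I E S i j"
proof -
  have "z 0 \<in> S ` I" "z 1 \<in> S ` I" using assms(4-7) by (metis imageI)+
  then obtain S' where S': "reaches I (Restr E (range z)) S S'" "z (-1) \<notin> S' ` I"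
    and fixed: "\<And>k. S k \<in> {z 0, z 1} \<Longrightarrow> S' k = S k"
    using reaches_vacant_before[OF cycle symE assms(1,3)] by blast
  have at: "S' i = z 0" "S' j = z 1" using fixed[of i] fixed[of j] assms(6,7) by simp_all
  have "exchangeable I E S' i j"
  proof (rule exchangeable_star[OF symE reaches_inj_on[OF S'(1) assms(1)] assms(4,5)])
    show "i \<noteq> j" using at cycle_walk_eq_iff[OF cycle, of 0 1] cycle_walk_length[OF cycle] by auto
    show "(S' i, S' j) \<in> E" using at cycle_walk_edge[OF cycle, of 0] by simp
    show "(S' i, w) \<in> E" using at pendant(2) by simp
    show "(S' i, z (-1)) \<in> E"
      using at cycle_walk_edge[OF cycle, of "-1"] symE by (auto dest: symD)
    show "w \<notin> S' ` I" using reaches_Restr_vacant[OF S'(1) pendant(1) assms(2)] .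
    show "w \<noteq> z (-1)" using pendant(1) by auto
  qed (rule S'(2))
  then show ?thesis
    using exchangeable_reaches[OF symE assms(1) reaches_Restr[OF S'(1)] assms(4,5)] by blast
qed

lemma exchangeable_adjacent:
  assumes "inj_on S I" "w \<notin> S ` I" "z h \<notin> S ` I" "i \<in> I" "j \<in> I" "S i = z a" "S j = z (a + 1)"
  shows "exchangeable I E S i j"
proof -
  have from_nat: "exchangeable I E S i j"
    if "inj_on S I" "w \<notin> S ` I" "z h \<notin> S ` I" "S i = z (int n)" "S j = z (int n + 1)" for S h n
    using that
  proof (induction n arbitrary: S h)
    case 0
    then show ?case using exchangeable_at_junction assms(4,5) by simp
  next
    case (Suc n)
    obtain S' where S': "reaches I (Restr E (range z)) S S'" "z (h - 1) \<notin> S' ` I"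
      and rotated: "\<And>i k. i \<in> I \<Longrightarrow> S i = z k \<Longrightarrow> S' i = z (k - 1)"
      using reaches_rotate[OF cycle symE Suc.prems(1,3)] by blast
    have "S' i = z (int n)" "S' j = z (int n + 1)"
      using rotated[OF assms(4) Suc.prems(4)] rotated[OF assms(5) Suc.prems(5)]
      by (simp_all add: add.commute)
    then have "exchangeable I E S' i j"
      using Suc.IH[OF reaches_inj_on[OF S'(1) Suc.prems(1)] _ S'(2)]
        reaches_Restr_vacant[OF S'(1) pendant(1) Suc.prems(2)] by blast
    then show ?case
      using exchangeable_reaches[OF symE Suc.prems(1) reaches_Restr[OF S'(1)] assms(4,5)] by blast
  qed
  have "m dvd a mod m - a" by (metis dvd_diff_commute dvd_minus_mod)
  then have "z (a mod m) = z a" "z (a mod m + 1) = z (a + 1)"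
    using cycle_walk_eq_iff[OF cycle] by simp_all
  moreover have "int (nat (a mod m)) = a mod m" using cycle_walk_length[OF cycle] by simp
  ultimately show ?thesis using from_nat[OF assms(1-3)] assms(6,7) by metis
qed

lemma exchangeable_on_cycle:
  assumes "inj_on S I" "w \<notin> S ` I" "z h \<notin> S ` I" "i \<in> I" "j \<in> I" "S i = z a" "S j = z (a + int d)"
  shows "exchangeable I E S i j"
  using assms
proof (induction d arbitrary: S h i a)
  case 0
  then have "i = j" by (metis add_0_right inj_onD of_nat_0)
  then show ?case by simp
next
  case (Suc d)
  have j: "S j = z (a + 1 + int d)" using Suc.prems(7) by (simp add: algebra_simps)
  consider (occupied) k where "k \<in> I" "S k = z (a + 1)" | (equal) "i = j"
    | (vacant) "z (a + 1) \<notin> S ` I" "i \<noteq> j"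
    by fastforce
  then show ?case
  proof cases
    case (occupied k)
    have "exchangeable I E S i k"
      using exchangeable_adjacent[OF Suc.prems(1-4) occupied(1) Suc.prems(6) occupied(2)] .
    moreover have "exchangeable I E S k j"
      using Suc.IH[OF Suc.prems(1-3) occupied(1) Suc.prems(5) occupied(2) j] .
    ultimately show ?thesis using exchangeable_trans Suc.prems(4,5) occupied(1) by metis
  next
    case vacant
    let ?S = "S(i := z (a + 1))"
    have slide: "slide I E S ?S"
      using Suc.prems(4,6) vacant(1) cycle_walk_edge[OF cycle] by (intro slideI) simp_all
    have im: "?S ` I = insert (z (a + 1)) (S ` I - {z a})"
      using image_fun_upd_inj_on[OF Suc.prems(1,4)] Suc.prems(6) by simp
    have "exchangeable I E ?S i j"
    proof (rule Suc.IH[OF slide_inj_on[OF slide Suc.prems(1)] _ _ Suc.prems(4,5)])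
      show "w \<notin> ?S ` I" using im Suc.prems(2) pendant(1) by auto
      show "z a \<notin> ?S ` I"
        using im vacant(1) Suc.prems(4,6) by (metis DiffE imageI insertE singletonI)
      show "?S j = z (a + 1 + int d)" using vacant(2) j by simp
    qed simp
    then show ?thesis
      using exchangeable_reaches[OF symE Suc.prems(1) slide_reaches[OF slide] Suc.prems(4,5)]
      by blast
  qed simp
qed

end

section \<open>Interchangeable sets\<close>

definition interchangeable :: "'b set \<Rightarrow> 'a rel \<Rightarrow> nat \<Rightarrow> 'a set \<Rightarrow> bool" where
  "interchangeable I E k K \<longleftrightarrow>
    (\<forall>S. inj_on S I \<longrightarrow> k \<le> card (K - S ` I) \<longrightarrow>
         (\<forall>i\<in>I. \<forall>j\<in>I. S i \<in> K \<longrightarrow> S j \<in> K \<longrightarrow> exchangeable I E S i j))"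

lemma interchangeable_mono:
  assumes "interchangeable I E k L" "K \<subseteq> L" "k \<le> k'" "finite L"
  shows "interchangeable I E k' K"
proof -
  have "card (K - S ` I) \<le> card (L - S ` I)" for S
    using assms(2,4) by (intro card_mono) auto
  then show ?thesis
    using assms(1-3) unfolding interchangeable_def by (meson le_trans subsetD)
qed

lemma interchangeableD:
  assumes "interchangeable I E k K" "finite K" "inj_on S I"
    and "A \<subseteq> K" "A \<inter> S ` I = {}" "k \<le> card A"
    and "i \<in> I" "j \<in> I" "S i \<in> K" "S j \<in> K"
  shows "exchangeable I E S i j"
proof -
  have "card A \<le> card (K - S ` I)" using assms(2,4,5) by (intro card_mono) auto
  then show ?thesis using assms unfolding interchangeable_def by (meson le_trans)
qed

lemma interchangeableI_rearranged:
  assumes "sym E" "connected_in E K" "finite K"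
    and "A \<subseteq> K" "B \<subseteq> K" "A \<inter> B = {}" "card A \<le> k" "card B \<le> 2"
    and rearranged: "\<And>S i j. inj_on S I \<Longrightarrow> A \<inter> S ` I = {} \<Longrightarrow> B \<subseteq> S ` I \<Longrightarrow>
      i \<in> I \<Longrightarrow> j \<in> I \<Longrightarrow> S i \<in> K \<Longrightarrow> S j \<in> K \<Longrightarrow> exchangeable I E S i j"
  shows "interchangeable I E k K"
  unfolding interchangeable_def
proof (intro allI impI ballI)
  fix S i j
  assume S: "inj_on S I" "k \<le> card (K - S ` I)"
    and ij: "i \<in> I" "j \<in> I" "S i \<in> K" "S j \<in> K"
  show "exchangeable I E S i j"
  proof (cases "i = j")
    case False
    then have "S i \<noteq> S j" using ij(1,2) S(1) by (auto dest: inj_onD)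
    then have "card {S i, S j} = 2" by simp
    moreover have "card {S i, S j} \<le> card (K \<inter> S ` I)" using ij assms(3) by (intro card_mono) auto
    ultimately have "card B \<le> card (K \<inter> S ` I)" using assms(8) by simp
    moreover have "card A \<le> card (K - S ` I)" using assms(7) S(2) by simp
    ultimately obtain S' where S': "reaches I (Restr E K) S S'" "A \<inter> S' ` I = {}" "B \<subseteq> S' ` I"
      using reaches_rearranged[OF assms(1-3) S(1) assms(4-6)] by blast
    have "S' i \<in> K" "S' j \<in> K" using reaches_Restr_mem_iff[OF S'(1)] ij by simp_all
    then have "exchangeable I E S' i j"
      using rearranged[OF reaches_inj_on[OF S'(1) S(1)] S'(2,3) ij(1,2)] by simp
    then show ?thesis
      using exchangeable_reaches[OF assms(1) S(1) reaches_Restr[OF S'(1)] ij(1,2)] by simp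
  qed simp
qed

lemma interchangeable_lollipop:
  assumes "sym E" "cycle_set E C" "x \<in> C" "w \<notin> C" "(x, w) \<in> E"
  shows "interchangeable I E 2 (insert w C)"
proof (rule interchangeableI_rearranged[OF assms(1), where A = "{x, w}" and B = "{}"])
  show "connected_in E (insert w C)"
    using connected_in_insert[OF assms(1) connected_in_cycle_set[OF assms(1,2)] assms(3,5)] .
  show "finite (insert w C)" using finite_cycle_set[OF assms(2)] by simp
  show "{x, w} \<subseteq> insert w C" using assms(3) by simp
  show "card {x, w} \<le> 2" by (simp add: card_insert_if)
next
  fix S i j
  assume S: "inj_on S I" "{x, w} \<inter> S ` I = {}"
    and ij: "i \<in> I" "j \<in> I" "S i \<in> insert w C" "S j \<in> insert w C"
  obtain m z where z: "cycle_walk E m z" "C = range z" "x = z 0"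
    using cycle_set_startE[OF assms(2,3)] .
  interpret lollipop E m z w using assms(1,4,5) z by unfold_locales simp_all
  have vacant: "w \<notin> S ` I" "z 0 \<notin> S ` I" using S(2) z(3) by auto
  then have "S i \<in> range z" "S j \<in> range z" using ij z(2) by auto
  then obtain a where a: "S i = z a" by blast
  obtain b where b: "a \<le> b" "S j = z b"
    using cycle_walk_indexE[OF z(1) \<open>S j \<in> range z\<close>] by blast
  then have "S j = z (a + int (nat (b - a)))" by simp
  then show "exchangeable I E S i j"
    using exchangeable_on_cycle[OF S(1) vacant ij(1,2) a] by blast
qed simp_all

lemma interchangeable_Un_linked:
  assumes "sym E" "connected_in E (K \<union> L)" "finite K" "finite L"
    and K: "interchangeable I E k K" and L: "interchangeable I E l L"
    and A: "A \<subseteq> K" "card A = k" "l \<le> card (A \<inter> L)"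
    and bc: "b \<in> K - A" "c \<in> L - A"
    and link: "\<And>S e f. inj_on S I \<Longrightarrow> A \<inter> S ` I = {} \<Longrightarrow> e \<in> I \<Longrightarrow> f \<in> I \<Longrightarrow>
      S e = b \<Longrightarrow> S f = c \<Longrightarrow> exchangeable I E S e f"
  shows "interchangeable I E k (K \<union> L)"
proof (rule interchangeableI_rearranged[OF assms(1,2), where A = A and B = "{b, c}"])
  show "card {b, c} \<le> 2" by (simp add: card_insert_if)
next
  fix S i j
  assume S: "inj_on S I" "A \<inter> S ` I = {}" "{b, c} \<subseteq> S ` I"
    and ij: "i \<in> I" "j \<in> I" "S i \<in> K \<union> L" "S j \<in> K \<union> L"
  obtain e f where e: "e \<in> I" "S e = b" and f: "f \<in> I" "S f = c" using S(3) by auto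
  have to_e: "exchangeable I E S q e" if q: "q \<in> I" "S q \<in> K \<union> L" for q
  proof (cases "S q \<in> K")
    case True
    then show ?thesis
      using interchangeableD[OF K assms(3) S(1) A(1) S(2) _ q(1) e(1)] A(2) bc(1) e(2) by simp
  next
    case False
    then have "exchangeable I E S q f"
      using interchangeableD[OF L assms(4) S(1), of "A \<inter> L" q f] A(3) S(2) q f bc(2) by auto
    moreover have "exchangeable I E S f e"
      using exchangeable_sym[OF link[OF S(1,2) e(1) f(1) e(2) f(2)]] .
    ultimately show ?thesis using exchangeable_trans q(1) e(1) f(1) by metis
  qed
  show "exchangeable I E S i j"
    using exchangeable_trans[OF ij(1) e(1) ij(2) to_e exchangeable_sym[OF to_e]] ij by blast
qed (use assms(3,4) A bc in auto)

lemma interchangeable_Un: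
  assumes "sym E" "connected_in E (K \<union> L)" "finite K" "finite L"
    and K: "interchangeable I E k K" "k < card K"
    and L: "interchangeable I E l L" "l < card (K \<inter> L)" "l \<le> k"
  shows "interchangeable I E k (K \<union> L)"
proof -
  obtain b where b: "b \<in> K \<inter> L" using L(2) by (metis card.empty ex_in_conv not_less_zero)
  then have "l \<le> card (K \<inter> L - {b})" "k \<le> card (K - {b})" using K(2) L(2) assms(3) by simp_all
  then obtain A\<^sub>0 where A\<^sub>0: "A\<^sub>0 \<subseteq> K \<inter> L - {b}" "card A\<^sub>0 = l"
    by (meson obtain_subset_with_card_n)
  have "\<exists>A. A\<^sub>0 \<subseteq> A \<and> A \<subseteq> K - {b} \<and> card A = k"
    by (rule exists_subset_between) (use A\<^sub>0 L(3) \<open>k \<le> card (K - {b})\<close> assms(3) in auto)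
  then obtain A where A: "A\<^sub>0 \<subseteq> A" "A \<subseteq> K - {b}" "card A = k" by blast
  have "finite A" using A(2) assms(3) by (meson finite_Diff finite_subset)
  then have holes: "l \<le> card (A \<inter> L)" using A\<^sub>0 A(1) card_mono[of "A \<inter> L" A\<^sub>0] by auto
  show ?thesis
  proof (rule interchangeable_Un_linked[OF assms(1-4) K(1) L(1) _ A(3) holes])
    show "exchangeable I E S e f"
      if "inj_on S I" "e \<in> I" "f \<in> I" "S e = b" "S f = b" for S e f
      using that by (metis exchangeable_refl inj_onD)
  qed (use A(2) b in auto)
qed

lemma interchangeable_Un_bridge:
  assumes "sym E" "connected_in E (K \<union> L)" "finite K" "finite L"
    and K: "interchangeable I E 3 K"
    and L: "interchangeable I E 2 L" "x \<in> L" "v \<in> L" "c \<in> L - K" "(v, c) \<in> E"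
    and J: "interchangeable I E 2 J" "J \<subseteq> K" "x \<in> J" "v \<in> J" "x \<noteq> v" "4 \<le> card J"
  shows "interchangeable I E 3 (K \<union> L)"
proof -
  have finJ: "finite J" using J(2) assms(3) finite_subset by blast
  then have "2 \<le> card (J - {x, v})" using J(3-6) by (simp add: card_Diff_subset)
  then obtain a b where ab: "a \<in> J - {x, v}" "b \<in> J - {x, v}" "a \<noteq> b"
    by (auto simp: numeral_2_eq_2 card_le_Suc_iff)
  have xva: "{x, v, a} \<subseteq> K" "card {x, v, a} = 3" using J(2-5) ab(1) by auto
  show ?thesis
  proof (rule interchangeable_Un_linked[OF assms(1-4) K L(1) xva])
    have "card {x, v} \<le> card ({x, v, a} \<inter> L)" using L(2,3) by (intro card_mono) auto
    then show "2 \<le> card ({x, v, a} \<inter> L)" using J(5) by simp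
    show "b \<in> K - {x, v, a}" "c \<in> L - {x, v, a}" using ab J L(4) by auto
  next
    fix S e f
    assume S: "inj_on S I" "{x, v, a} \<inter> S ` I = {}"
      and e: "e \<in> I" "S e = b" and f: "f \<in> I" "S f = c"
    let ?S = "S(f := v)"
    have "c \<notin> J" using L(4) J(2) by blast
    have slide: "slide I E S ?S"
      using f S(2) symD[OF assms(1) L(5)] by (intro slideI) auto
    have "exchangeable I E ?S e f"
    proof (rule interchangeableD[OF J(1) finJ slide_inj_on[OF slide S(1)], of "{x, a}"])
      show "{x, a} \<inter> ?S ` I = {}" using image_fun_upd_inj_on[OF S(1) f(1)] S(2) J(5) ab(1) by auto
      show "2 \<le> card {x, a}" using ab(1) by auto
      show "?S e \<in> J" using e(2) f(2) ab(2) \<open>c \<notin> J\<close> by auto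
    qed (use J(3,4) ab e(1) f(1) in auto)
    then show "exchangeable I E S e f"
      using exchangeable_reaches[OF assms(1) S(1) slide_reaches[OF slide] e(1) f(1)] by blast
  qed
qed

lemma interchangeable_proper_cycle:
  assumes "sym E" "connected_in E V" "cycle_set E C" "C \<subset> V"
  shows "interchangeable I E 2 C"
proof -
  have "C \<noteq> {}" using card_cycle_set[OF assms(3)] by auto
  then obtain x w where "x \<in> C" "w \<in> V - C" "(x, w) \<in> E"
    using connected_in_boundary[OF assms(2,4)] by blast
  then have "interchangeable I E 2 (insert w C)"
    using interchangeable_lollipop[OF assms(1,3)] by blast
  then show ?thesis by (rule interchangeable_mono) (use finite_cycle_set[OF assms(3)] in auto)
qed

lemma interchangeable_insert_neighbour:
  assumes "sym E" "finite K" "connected_in E K" "interchangeable I E 3 K"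
    and C: "cycle_set E C" "C \<subseteq> K" "x \<in> C" and v: "v \<notin> K" "(x, v) \<in> E"
  shows "interchangeable I E 3 (insert v K)"
proof -
  have lollipop: "interchangeable I E 2 (insert v C)"
    using interchangeable_lollipop[OF assms(1) C(1,3) _ v(2)] C(2) v(1) by blast
  show ?thesis
  proof (cases "K = C")
    case True
    then show ?thesis using interchangeable_mono[OF lollipop] assms(2) by simp
  next
    case False
    have "insert v K = K \<union> insert v C" using C(2) by auto
    moreover have "interchangeable I E 3 (K \<union> insert v C)"
    proof (rule interchangeable_Un[OF assms(1) _ assms(2) _ assms(4) _ lollipop])
      have "connected_in E (insert v K)"
        using connected_in_insert[OF assms(1,3) _ v(2)] C(2,3) by blast
      then show "connected_in E (K \<union> insert v C)" using \<open>insert v K = K \<union> insert v C\<close> by simp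
      have "card C < card K" using False C(2) assms(2) by (intro psubset_card_mono) auto
      then show "3 < card K" using card_cycle_set[OF C(1)] by simp
      have "K \<inter> insert v C = C" using C(2) v(1) by auto
      then show "2 < card (K \<inter> insert v C)" using card_cycle_set[OF C(1)] by simp
    qed (use finite_cycle_set[OF C(1)] in simp_all)
    ultimately show ?thesis by simp
  qed
qed

lemma interchangeable_Un_cycle_overlap:
  assumes "sym E" "finite K" "connected_in E K" "interchangeable I E 3 K" "3 < card K"
    and C: "cycle_set E C" "\<not> K \<subseteq> C" "2 \<le> card (K \<inter> C)"
  shows "interchangeable I E 3 (K \<union> C)"
proof -
  have "K \<inter> C \<subset> K" "K \<inter> C \<noteq> {}" using C(2,3) by auto
  then obtain a w where aw: "a \<in> K \<inter> C" "w \<in> K - K \<inter> C" "(a, w) \<in> E"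
    using connected_in_boundary[OF assms(3)] by blast
  then have lollipop: "interchangeable I E 2 (insert w C)"
    using interchangeable_lollipop[OF assms(1) C(1)] by blast
  have Un: "K \<union> insert w C = K \<union> C" using aw(2) by auto
  have "interchangeable I E 3 (K \<union> insert w C)"
  proof (rule interchangeable_Un[OF assms(1) _ assms(2) _ assms(4,5) lollipop])
    show "connected_in E (K \<union> insert w C)" unfolding Un
      using connected_in_Un[OF assms(1,3) connected_in_cycle_set[OF assms(1) C(1)], of a a] aw(1)
      by blast
    have "K \<inter> insert w C = insert w (K \<inter> C)" using aw(2) by auto
    then show "2 < card (K \<inter> insert w C)" using aw(2) C(3) assms(2) by simp
  qed (use finite_cycle_set[OF C(1)] in simp_all)
  then show ?thesis unfolding Un .
qed

lemma interchangeable_Un_cycle_bridge: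
  assumes "sym E" "finite K" "connected_in E K" "interchangeable I E 3 K"
    and C: "cycle_set E C" "C \<subseteq> K" "x \<in> C"
    and D: "cycle_set E D" "K \<inter> D = {}" "v \<in> D" "(x, v) \<in> E"
  shows "interchangeable I E 3 (K \<union> D)"
proof -
  have disjoint: "v \<notin> K" "x \<notin> D" using C(2,3) D(2,3) by auto
  have Un: "insert v K \<union> insert x D = K \<union> D" using C(2,3) D(3) by auto
  have "D \<noteq> {v}" using card_cycle_set[OF D(1)] by auto
  then have "{v} \<subset> D" "{v} \<noteq> {}" using D(3) by auto
  then obtain c where c: "c \<in> D - {v}" "(v, c) \<in> E"
    using connected_in_boundary[OF connected_in_cycle_set[OF assms(1) D(1)]] by (metis singletonD)
  have "interchangeable I E 3 (insert v K \<union> insert x D)"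
  proof (rule interchangeable_Un_bridge[OF assms(1)])
    show "connected_in E (insert v K \<union> insert x D)" unfolding Un
      using connected_in_Un[OF assms(1,3) connected_in_cycle_set[OF assms(1) D(1)]] C(2,3) D(3,4)
      by blast
    show "interchangeable I E 3 (insert v K)"
      using interchangeable_insert_neighbour[OF assms(1-4) C disjoint(1) D(4)] .
    show "interchangeable I E 2 (insert x D)"
      using interchangeable_lollipop[OF assms(1) D(1,3) disjoint(2) symD[OF assms(1) D(4)]] .
    show "interchangeable I E 2 (insert v C)"
      using interchangeable_lollipop[OF assms(1) C(1,3) _ D(4)] C(2) disjoint(1) by blast
    show "c \<in> insert x D - insert v K" "(v, c) \<in> E" using c D(2) by auto
    have "v \<notin> C" using C(2) disjoint(1) by blast
    then show "4 \<le> card (insert v C)"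
      using card_cycle_set[OF C(1)] finite_cycle_set[OF C(1)] by simp
  qed (use assms(2) finite_cycle_set[OF D(1)] C(2,3) D(3) disjoint in auto)
  then show ?thesis unfolding Un .
qed

lemma interchangeable_Un_cycle:
  assumes "sym E" "finite V" "connected_in E V"
    and K: "K \<subseteq> V" "connected_in E K" "interchangeable I E 3 K"
    and C: "cycle_set E C" "C \<subseteq> K" "x \<in> C"
    and D: "cycle_set E D" "D \<subset> V" "v \<in> D" "v \<notin> K" "(x, v) \<in> E"
  shows "interchangeable I E 3 (K \<union> D)"
proof -
  have finK: "finite K" using K(1) assms(2) finite_subset by blast
  consider (inside) "insert v K \<subseteq> D" | (disjoint) "K \<inter> D = {}"
    | (overlap) u where "\<not> insert v K \<subseteq> D" "u \<in> K \<inter> D"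
    by blast
  then show ?thesis
  proof cases
    case inside
    then have "K \<union> D = D" by auto
    then show ?thesis
      using interchangeable_mono[OF interchangeable_proper_cycle[OF assms(1,3) D(1,2)], of D 3]
        finite_cycle_set[OF D(1)] by simp
  next
    case disjoint
    then show ?thesis
      using interchangeable_Un_cycle_bridge[OF assms(1) finK K(2,3) C D(1)] D(3,5) by blast
  next
    case (overlap u)
    have "interchangeable I E 3 (insert v K \<union> D)"
    proof (rule interchangeable_Un_cycle_overlap[OF assms(1) _ _ _ _ D(1) overlap(1)])
      show "connected_in E (insert v K)"
        using connected_in_insert[OF assms(1) K(2) _ D(5)] C(2,3) by blast
      show "interchangeable I E 3 (insert v K)"
        using interchangeable_insert_neighbour[OF assms(1) finK K(2,3) C D(4,5)] .
      have "card C \<le> card K" using C(2) finK by (rule card_mono[rotated])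
      then show "3 < card (insert v K)" using card_cycle_set[OF C(1)] finK D(4) by simp
      have "card {u, v} \<le> card (insert v K \<inter> D)"
        using overlap(2) D(3) finK by (intro card_mono) auto
      then show "2 \<le> card (insert v K \<inter> D)" using overlap(2) D(4) by (cases "u = v") auto
    qed (simp add: finK)
    moreover have "insert v K \<union> D = K \<union> D" using D(3) by auto
    ultimately show ?thesis by simp
  qed
qed

lemma interchangeable_proper_cycles:
  assumes "sym E" "finite V" "connected_in E V"
    and cycles: "\<And>v. v \<in> V \<Longrightarrow> \<exists>C. cycle_set E C \<and> v \<in> C \<and> C \<subset> V"
  shows "interchangeable I E 3 V"
proof (cases "V = {}")
  case True
  then show ?thesis by (simp add: interchangeable_def)
next
  case False
  define P where "P K \<longleftrightarrow> connected_in E K \<and> interchangeable I E 3 K \<and>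
    (\<forall>x\<in>K. \<exists>C. cycle_set E C \<and> x \<in> C \<and> C \<subseteq> K)" for K
  obtain C where C: "cycle_set E C" "C \<noteq> {}" "C \<subset> V" using cycles False by blast
  have "P V"
  proof (rule connected_in_induct[OF assms(2,3), of C])
    have "interchangeable I E 3 C"
      using interchangeable_mono[OF interchangeable_proper_cycle[OF assms(1,3) C(1,3)], of C 3]
        finite_cycle_set[OF C(1)] by simp
    then show "P C" unfolding P_def using C(1) connected_in_cycle_set[OF assms(1) C(1)] by blast
  next
    fix K x v assume K: "P K" "K \<subseteq> V" and xv: "x \<in> K" "v \<in> V - K" "(x, v) \<in> E"
    obtain D where D: "cycle_set E D" "v \<in> D" "D \<subset> V" using cycles xv(2) by blast
    obtain C where C: "cycle_set E C" "C \<subseteq> K" "x \<in> C" using K(1) xv(1) unfolding P_def by blast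
    have "connected_in E K" "interchangeable I E 3 K" using K(1) unfolding P_def by simp_all
    then have "interchangeable I E 3 (K \<union> D)" "connected_in E (K \<union> D)"
      using interchangeable_Un_cycle[OF assms(1-3) K(2) _ _ C D(1,3,2) _ xv(3)] xv(2)
        connected_in_Un[OF assms(1) _ connected_in_cycle_set[OF assms(1) D(1)] xv(1) D(2)] xv(3)
      by simp_all
    moreover have "\<forall>y\<in>K \<union> D. \<exists>C. cycle_set E C \<and> y \<in> C \<and> C \<subseteq> K \<union> D"
      using K(1) D(1) unfolding P_def by (metis Un_iff Un_upper2 le_supI1)
    ultimately show "\<exists>K'. P K' \<and> K \<subset> K' \<and> K' \<subseteq> V"
      using K(2) D(2,3) xv(2) unfolding P_def by (intro exI[of _ "K \<union> D"]) auto
  qed (use C in auto)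
  then show ?thesis unfolding P_def by simp
qed

section \<open>Finding cycles\<close>

lemma cycle_set_closed_path:
  fixes f :: "int \<Rightarrow> 'a"
  assumes "a + 2 \<le> b" "inj_on f {a..b}"
    and "\<And>i. a \<le> i \<Longrightarrow> i < b \<Longrightarrow> (f i, f (i + 1)) \<in> E" "(f b, f a) \<in> E"
  shows "cycle_set E (f ` {a..b})"
proof -
  define m where "m = b - a + 1"
  define z where "z k = f (a + k mod m)" for k
  have m: "3 \<le> m" using assms(1) by (simp add: m_def)
  have in_range: "a + k mod m \<in> {a..b}" for k
    using pos_mod_bound[of m k] pos_mod_sign[of m k] m by (simp add: m_def)
  have "z i = z j \<longleftrightarrow> m dvd i - j" for i j
    unfolding z_def using inj_on_eq_iff[OF assms(2) in_range in_range]
    by (simp add: mod_eq_dvd_iff)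
  moreover have "(z k, z (k + 1)) \<in> E" for k
  proof (cases "k mod m = m - 1")
    case True
    then have "(k + 1) mod m = 0" using mod_add_left_eq[of k m 1] by simp
    then show ?thesis using True assms(4) by (simp add: z_def m_def)
  next
    case False
    moreover have bounds: "0 \<le> k mod m" "k mod m < m" using m by simp_all
    ultimately have less: "k mod m + 1 < m" by linarith
    then have "(k + 1) mod m = k mod m + 1"
      using mod_add_left_eq[of k m 1] mod_pos_pos_trivial[of "k mod m + 1" m] bounds by simp
    then show ?thesis
      using assms(3)[of "a + k mod m"] less bounds by (simp add: z_def m_def add.assoc)
  qed
  ultimately have "cycle_walk E m z" unfolding cycle_walk_def using m by simp
  moreover have "range z = f ` {a..b}"
  proof
    show "range z \<subseteq> f ` {a..b}" unfolding z_def using in_range by blast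
    have "f i = z (i - a)" if "i \<in> {a..b}" for i using that by (simp add: z_def m_def)
    then show "f ` {a..b} \<subseteq> range z" by auto
  qed
  ultimately show ?thesis unfolding cycle_set_def by metis
qed

lemma cycle_set_arc:
  assumes "cycle_walk E m z" "a + 2 \<le> b" "b + 1 < a + m" "(z b, z a) \<in> E"
  shows "cycle_set E (z ` {a..b})" "z ` {a..b} \<subset> range z"
proof -
  show "cycle_set E (z ` {a..b})"
    using cycle_walk_inj_on[OF assms(1)] cycle_walk_edge[OF assms(1)] assms(2-4)
    by (intro cycle_set_closed_path) simp_all
  have "z (b + 1) \<notin> z ` {a..b}"
    using inj_on_image_mem_iff[OF cycle_walk_inj_on[OF assms(1,3)], of "b + 1" "{a..b}"] assms(2)
    by auto
  then show "z ` {a..b} \<subset> range z" by auto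
qed

definition cycle_edges :: "(int \<Rightarrow> 'a) \<Rightarrow> 'a rel" where
  "cycle_edges z = range (\<lambda>i. (z i, z (i + 1))) \<union> range (\<lambda>i. (z (i + 1), z i))"

lemma cycle_edges_subset: "cycle_walk E m z \<Longrightarrow> sym E \<Longrightarrow> cycle_edges z \<subseteq> E"
  unfolding cycle_edges_def by (auto dest: cycle_walk_edge symD)

lemma cycle_set_chord:
  assumes "cycle_walk E m z" "sym E"
    and "(s, t) \<in> E - cycle_edges z" "s \<in> range z" "t \<in> range z" "s \<noteq> t" "v \<in> range z"
  shows "\<exists>C. cycle_set E C \<and> v \<in> C \<and> C \<subset> range z"
proof -
  obtain a where a: "s = z a" using assms(4) by blast
  obtain b where b: "a \<le> b" "b < a + m" "t = z b" using cycle_walk_indexE[OF assms(1,5)] .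
  obtain k where k: "a \<le> k" "k < a + m" "v = z k" using cycle_walk_indexE[OF assms(1,7)] .
  have za: "z (a + m) = z a" using cycle_walk_periodic[OF assms(1)] .
  have "b \<noteq> a" using assms(6) a b(3) by auto
  moreover have "b \<noteq> a + 1" using assms(3) a b(3) by (auto simp: cycle_edges_def)
  moreover have "b + 1 \<noteq> a + m"
  proof
    assume "b + 1 = a + m"
    then have "(s, t) = (z (b + 1), z b)" using a b(3) za by simp
    then show False using assms(3) by (auto simp: cycle_edges_def)
  qed
  ultimately have ab: "a + 2 \<le> b" "b + 1 < a + m" using b(1,2) by linarith+
  have edges: "(z b, z a) \<in> E" "(z (a + m), z b) \<in> E"
    using assms(2,3) a b(3) za by (auto dest: symD)
  have "b + 2 \<le> a + m" "a + m + 1 < b + m" using ab by simp_all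
  note arcs = cycle_set_arc[OF assms(1) ab edges(1)] cycle_set_arc[OF assms(1) this edges(2)]
  have "v \<in> z ` {a..b} \<or> v \<in> z ` {b..a + m}" using k by (cases "k \<le> b") auto
  then show ?thesis using arcs by metis
qed

lemma cycle_set_through_edge:
  assumes "(u, v) \<in> R\<^sup>*" "R \<subseteq> E" "(v, u) \<in> E - R\<inverse>" "u \<noteq> v"
  shows "\<exists>C. cycle_set E C \<and> u \<in> C \<and> v \<in> C"
proof -
  let ?R = "\<lambda>x y. (x, y) \<in> R"
  have "?R\<^sup>*\<^sup>* u v" using assms(1) by (simp add: rtranclp_rtrancl_eq)
  then obtain xs where xs: "rtrancl_path ?R u xs v" "distinct (u # xs)"
    unfolding rtranclp_eq_rtrancl_path by (blast elim: rtrancl_path_distinct)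
  let ?n = "int (length xs)" and ?f = "\<lambda>i. (u # xs) ! nat i"
  have step: "(?f (int i), xs ! i) \<in> R" if "i < length xs" for i
    using rtrancl_path_nth[OF xs(1) that] by simp
  have "xs \<noteq> []" using xs(1) assms(4) by (auto elim: rtrancl_path.cases)
  then have last: "xs ! (length xs - 1) = v"
    using rtrancl_path_last[OF xs(1)] by (simp add: last_conv_nth)
  then have "length xs \<noteq> 1" using step[of 0] assms(3) \<open>xs \<noteq> []\<close> by auto
  moreover have "length xs \<noteq> 0" using \<open>xs \<noteq> []\<close> by simp
  ultimately have len: "2 \<le> length xs" by linarith
  have ends: "?f 0 = u" "?f ?n = v" using last \<open>xs \<noteq> []\<close> by (simp_all add: nth_Cons')
  have "cycle_set E (?f ` {0..?n})"
  proof (rule cycle_set_closed_path)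
    show "0 + 2 \<le> ?n" using len by simp
    show "inj_on ?f {0..?n}"
      using xs(2) by (intro inj_onI)
        (auto simp: nth_eq_iff_index_eq nat_le_iff nat_less_iff simp del: distinct.simps)
    show "(?f i, ?f (i + 1)) \<in> E" if "0 \<le> i" "i < ?n" for i
      using step[of "nat i"] that assms(2) by (auto simp: nat_add_distrib)
    show "(?f ?n, ?f 0) \<in> E" using ends assms(3) by simp
  qed
  moreover have "?f 0 \<in> ?f ` {0..?n}" "?f ?n \<in> ?f ` {0..?n}" by (intro imageI; simp)+
  ultimately show ?thesis unfolding ends by blast
qed

definition cycle_verts :: "'a rel \<Rightarrow> 'a set" where
  "cycle_verts E = \<Union>{C. cycle_set E C}"

lemma cycle_verts_mono:
  assumes "E \<subseteq> F"
  shows "cycle_verts E \<subseteq> cycle_verts F"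
  using assms unfolding cycle_verts_def cycle_set_def cycle_walk_def by blast

lemma cycle_verts_subset:
  assumes "E \<subseteq> V \<times> V"
  shows "cycle_verts E \<subseteq> V"
proof
  fix v assume "v \<in> cycle_verts E"
  then obtain m z i where "cycle_walk E m z" "v = z i"
    unfolding cycle_verts_def cycle_set_def by blast
  then show "v \<in> V" using cycle_walk_edge[of E m z i] assms by auto
qed

section \<open>Contracting unoccupied vertices\<close>

definition contract :: "'a rel \<Rightarrow> 'a set \<Rightarrow> 'a rel" where
  "contract E N = {(u, v). u \<notin> N \<and> v \<notin> N \<and> (u, v) \<in> (Restr E (N \<union> {u, v}))\<^sup>*}"

lemma contract_edge: "(u, v) \<in> E \<Longrightarrow> u \<notin> N \<Longrightarrow> v \<notin> N \<Longrightarrow> (u, v) \<in> contract E N"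
  unfolding contract_def by auto

lemma sym_contract:
  assumes "sym E"
  shows "sym (contract E N)"
proof (rule symI)
  fix u v assume uv: "(u, v) \<in> contract E N"
  have "sym ((Restr E (N \<union> {u, v}))\<^sup>*)" by (intro sym_rtrancl sym_Restr assms)
  then have "(v, u) \<in> (Restr E (N \<union> {v, u}))\<^sup>*"
    using uv unfolding contract_def by (simp add: insert_commute symD)
  then show "(v, u) \<in> contract E N" using uv unfolding contract_def by simp
qed

lemma cycle_set_contract:
  assumes "cycle_set E C" "C \<inter> N = {}"
  shows "cycle_set (contract E N) C"
proof -
  obtain m z where z: "cycle_walk E m z" "C = range z"
    using assms(1) unfolding cycle_set_def by blast
  have "(z i, z (i + 1)) \<in> contract E N" for i
    using cycle_walk_edge[OF z(1)] assms(2) z(2) by (intro contract_edge) auto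
  then have "cycle_walk (contract E N) m z" using z(1) unfolding cycle_walk_def by blast
  then show ?thesis using z(2) unfolding cycle_set_def by blast
qed

lemma connected_in_contract:
  assumes "connected_in E V"
  shows "connected_in (contract E N) (V - N)"
  unfolding connected_in_def
proof (intro ballI)
  let ?C = "Restr (contract E N) (V - N)"
  fix u v assume uv: "u \<in> V - N" "v \<in> V - N"
  have hop: "(x, y) \<in> ?C\<^sup>*" if "x \<in> V - N" "y \<in> V - N" "(x, y) \<in> (Restr E (N \<union> {x, y}))\<^sup>*" for x y
    using that by (auto simp: contract_def)
  have "(u, v) \<in> (Restr E V)\<^sup>*" using assms uv unfolding connected_in_def by blast
  then have "\<exists>x\<in>V - N. (u, x) \<in> ?C\<^sup>* \<and> (x, v) \<in> (Restr E (N \<union> {x, v}))\<^sup>*"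
  proof (induction rule: rtrancl_induct)
    case base
    then show ?case using uv(1) by blast
  next
    case (step y y')
    then obtain x where x: "x \<in> V - N" "(u, x) \<in> ?C\<^sup>*" "(x, y) \<in> (Restr E (N \<union> {x, y}))\<^sup>*"
      by blast
    show ?case
    proof (cases "y \<in> N")
      case True
      then have "(Restr E (N \<union> {x, y}))\<^sup>* \<subseteq> (Restr E (N \<union> {x, y'}))\<^sup>*"
        by (intro rtrancl_mono) auto
      moreover have "(y, y') \<in> Restr E (N \<union> {x, y'})" using step(2) True by auto
      ultimately have "(x, y') \<in> (Restr E (N \<union> {x, y'}))\<^sup>*"
        using x(3) by (meson rtrancl_into_rtrancl subsetD)
      then show ?thesis using x(1,2) by blast
    next
      case False
      then have "y \<in> V - N" using step(2) by auto
      moreover from this have "(u, y) \<in> ?C\<^sup>*" using x hop by (meson rtrancl_trans)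
      moreover have "(y, y') \<in> (Restr E (N \<union> {y, y'}))\<^sup>*" using step(2) by auto
      ultimately show ?thesis by blast
    qed
  qed
  then show "(u, v) \<in> ?C\<^sup>*" using hop uv(2) by (meson rtrancl_trans)
qed

lemma slide_contract:
  assumes "sym E" "inj_on S I" "S ` I \<inter> N = {}" "slide I (contract E N) S S'"
  shows "reaches I E S S'" "S' ` I \<inter> N = {}"
proof -
  obtain i v where i: "i \<in> I" "(S i, v) \<in> contract E N" "v \<notin> S ` I" and S': "S' = S(i := v)"
    using assms(4) by (rule slideE)
  let ?K = "N \<union> {S i, v}"
  have v: "v \<notin> N" "(v, S i) \<in> (Restr E ?K)\<^sup>*"
    using symD[OF sym_contract[OF assms(1)] i(2)] unfolding contract_def
    by (simp_all add: insert_commute)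
  show "S' ` I \<inter> N = {}" using assms(3) v(1) S' by auto
  obtain T where T: "reaches I (Restr E ?K) S T" "T ` I = insert v (S ` I - {S i})"
    using reaches_transfer_hole[OF v(2) sym_Restr[OF assms(1)] assms(2) i(3)] i(1) by blast
  have "T k = S' k" for k
  proof (cases "k = i")
    case True
    have "T i \<in> ?K" using reaches_Restr_mem_iff[OF T(1)] by auto
    moreover have "T i \<in> insert v (S ` I - {S i})" using T(2) i(1) by blast
    ultimately show ?thesis using assms(3) True S' by auto
  next
    case False
    have "S k \<notin> ?K" if "k \<in> I"
      using that False i(1,3) assms(2,3) by (auto dest: inj_onD)
    then have "T k = S k"
      using reaches_Restr_outside[OF T(1)] reaches_outside_index[OF T(1)] by blast
    then show ?thesis using False S' by simp
  qed
  then have "T = S'" by (rule ext)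
  then show "reaches I E S S'" using reaches_Restr[OF T(1)] by simp
qed

lemma reaches_contract:
  assumes "reaches I (contract E N) S S'" "sym E" "inj_on S I" "S ` I \<inter> N = {}"
  shows "reaches I E S S'"
proof -
  have "reaches I E S S' \<and> S' ` I \<inter> N = {}"
    using assms(1)
  proof (induction rule: reaches_induct)
    case (slide S1 S2)
    have "inj_on S1 I" using reaches_inj_on[OF slide(1) assms(3)] .
    moreover have "S1 ` I \<inter> N = {}" using slide(3) ..
    ultimately have "reaches I E S1 S2" "S2 ` I \<inter> N = {}"
      using slide_contract[OF assms(2) _ _ slide(2)] by simp_all
    then show ?case using slide(3) by (meson reaches_trans)
  qed (simp add: assms(4))
  then show ?thesis by blast
qed

lemma exchangeable_proper_cycles:
  assumes "sym E" "finite M" "connected_in E V" "M \<subseteq> V"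
    and cycles: "\<And>v. v \<in> M \<Longrightarrow> \<exists>C. cycle_set E C \<and> v \<in> C \<and> C \<subset> M"
    and S: "inj_on S I" "S ` I \<subseteq> M" "3 \<le> card (M - S ` I)" and ij: "i \<in> I" "j \<in> I"
  shows "exchangeable I E S i j"
proof -
  let ?E = "contract E (V - M)"
  have "V - (V - M) = M" using assms(4) by blast
  then have "connected_in ?E M" using connected_in_contract[OF assms(3), of "V - M"] by simp
  then have "interchangeable I ?E 3 M"
  proof (rule interchangeable_proper_cycles[OF sym_contract[OF assms(1)] assms(2)])
    fix v assume "v \<in> M"
    then obtain C where C: "cycle_set E C" "v \<in> C" "C \<subset> M" using cycles by blast
    then have "C \<inter> (V - M) = {}" by blast
    then show "\<exists>C. cycle_set ?E C \<and> v \<in> C \<and> C \<subset> M"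
      using cycle_set_contract[OF C(1)] C(2,3) by blast
  qed
  then have "exchangeable I ?E S i j" using S ij unfolding interchangeable_def by blast
  moreover have "S ` I \<inter> (V - M) = {}" using S(2) by blast
  ultimately show ?thesis
    unfolding exchangeable_def using reaches_contract assms(1) S(1) by blast
qed

section \<open>Permuting the pebbles of a graph that is not a cycle\<close>

definition cycle_rel :: "'a set \<Rightarrow> 'a rel \<Rightarrow> bool" where
  "cycle_rel V E \<longleftrightarrow> (\<exists>m z. cycle_walk E m z \<and> V = range z \<and> E = cycle_edges z)"

lemma proper_cycle_if_not_cycle_rel:
  assumes "sym E" "irrefl E" "E \<subseteq> V \<times> V" "\<not> cycle_rel V E" "cycle_set E V" "v \<in> V"
  shows "\<exists>C. cycle_set E C \<and> v \<in> C \<and> C \<subset> V"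
proof -
  obtain m z where z: "cycle_walk E m z" "V = range z"
    using assms(5) unfolding cycle_set_def by blast
  then have "E \<noteq> cycle_edges z" using assms(4) unfolding cycle_rel_def by blast
  then obtain s t where st: "(s, t) \<in> E - cycle_edges z"
    using cycle_edges_subset[OF z(1) assms(1)] by auto
  then have "s \<in> range z" "t \<in> range z" "s \<noteq> t" using assms(2,3) z(2) by (auto simp: irrefl_def)
  then show ?thesis using cycle_set_chord[OF z(1) assms(1) st] assms(6) z(2) by blast
qed

lemma exchangeable_in_cycle_verts:
  assumes E: "sym E" "irrefl E" "E \<subseteq> V \<times> V" and V: "finite V" "connected_in E V" "\<not> cycle_rel V E"
    and S: "inj_on S I" "S ` I \<subseteq> cycle_verts E" "3 \<le> card (cycle_verts E - S ` I)"
    and ij: "i \<in> I" "j \<in> I"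
  shows "exchangeable I E S i j"
proof -
  let ?M = "cycle_verts E"
  have MV: "?M \<subseteq> V" using cycle_verts_subset[OF E(3)] .
  then have finM: "finite ?M" using V(1) finite_subset by blast
  have in_M: "C \<subseteq> ?M" if "cycle_set E C" for C using that unfolding cycle_verts_def by blast
  show ?thesis
  proof (cases "cycle_set E ?M \<and> ?M \<noteq> V")
    case True
    then have "interchangeable I E 2 ?M"
      using interchangeable_proper_cycle[OF E(1) V(2)] MV by blast
    then have "interchangeable I E 3 ?M" by (rule interchangeable_mono) (use finM in auto)
    then show ?thesis using S ij unfolding interchangeable_def by blast
  next
    case False
    have "\<exists>C. cycle_set E C \<and> v \<in> C \<and> C \<subset> ?M" if v: "v \<in> ?M" for v
    proof (cases "cycle_set E ?M")
      case True
      then show ?thesis using proper_cycle_if_not_cycle_rel[OF E V(3)] False v by simp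
    next
      case not_cycle: False
      obtain C where "cycle_set E C" "v \<in> C" using v unfolding cycle_verts_def by blast
      then show ?thesis using in_M not_cycle by (metis psubsetI)
    qed
    then show ?thesis using exchangeable_proper_cycles[OF E(1) finM V(2) MV _ S ij] by blast
  qed
qed

lemma reaches_permuted_if_not_cycle_rel:
  assumes E: "sym E" "irrefl E" "E \<subseteq> V \<times> V" and V: "finite V" "connected_in E V" "\<not> cycle_rel V E"
    and I: "finite I" "card I + 3 \<le> card (cycle_verts E)"
    and S: "inj_on S I" "S ` I \<subseteq> V" and \<pi>: "\<pi> permutes I"
  shows "reaches I E S (S \<circ> \<pi>)"
proof -
  let ?M = "cycle_verts E"
  have "card I \<le> card ?M" using I(2) by simp
  then obtain T where T: "reaches I E S T" "T ` I \<subseteq> ?M"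
    using reaches_into[OF E(1) V(2,1) S cycle_verts_subset[OF E(3)]] by blast
  have injT: "inj_on T I" using reaches_inj_on[OF T(1) S(1)] .
  have "card (?M - T ` I) = card ?M - card I"
    using T(2) I(1) by (simp add: card_Diff_subset card_image[OF injT])
  then have holes: "3 \<le> card (?M - T ` I)" using I(2) by simp
  note T(1)
  also have "reaches I E T (T \<circ> \<pi>)"
    using reaches_permuted[OF I(1) exchangeable_in_cycle_verts[OF E V injT T(2) holes] \<pi>] .
  also have "reaches I E (T \<circ> \<pi>) (S \<circ> \<pi>)"
    using reaches_comp_permutes[OF \<pi> reaches_sym[OF E(1) S(1) T(1)]] .
  finally show ?thesis .
qed

section \<open>Pebble motion on graphs\<close>

lemma pair_graphD:
  assumes "pair_graph G"
  shows "sym (parcs G)" "irrefl (parcs G)" "parcs G \<subseteq> pverts G \<times> pverts G" "finite (pverts G)"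
proof -
  interpret pair_graph G by fact
  show "sym (parcs G)" using pair_sym_arcs by (simp add: symmetric_def)
  show "irrefl (parcs G)" using pair_no_loops by (fastforce simp: irrefl_def)
  show "parcs G \<subseteq> pverts G \<times> pverts G" using in_arcsD1 in_arcsD2 by auto
  show "finite (pverts G)" by (rule pair_finite_verts)
qed

lemma connected_rtrancl_parcs:
  assumes "Digraph_Component.connected (with_proj H)" "sym (parcs H)" "u \<in> pverts H" "v \<in> pverts H"
  shows "(u, v) \<in> (parcs H)\<^sup>*"
proof -
  have "parcs (mk_symmetric (with_proj H)) = parcs H"
    using assms(2) by (force simp: parcs_mk_symmetric dest: symD)
  moreover have "(u, v) \<in> rtrancl_on (pverts H) (parcs (mk_symmetric (with_proj H)))"
    using assms unfolding Digraph_Component.connected_def strongly_connected_def reachable_def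
    by simp
  ultimately show ?thesis using rtrancl_on_rtranclI by metis
qed

lemma connected_in_pverts:
  assumes "pair_graph G" "Digraph_Component.connected (with_proj G)"
  shows "connected_in (parcs G) (pverts G)"
proof -
  note G = pair_graphD[OF assms(1)]
  have "Restr (parcs G) (pverts G) = parcs G" using G(3) by auto
  then show ?thesis
    unfolding connected_in_def using connected_rtrancl_parcs[OF assms(2) G(1)] by simp
qed

lemma edge_in_cycle_set:
  assumes "pair_graph H" "two_edge_connected H" "(v, u) \<in> parcs H"
  shows "\<exists>C. cycle_set (parcs H) C \<and> u \<in> C \<and> v \<in> C"
proof (rule cycle_set_through_edge)
  note H = pair_graphD[OF assms(1)]
  let ?D = "delete_edge H v u"
  have D: "pverts ?D = pverts H" "parcs ?D = parcs H - {(v, u), (u, v)}"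
    by (simp_all add: delete_edge_def)
  have "Digraph_Component.connected (with_proj ?D)"
    using assms(2,3) unfolding two_edge_connected_def by blast
  moreover have "sym (parcs ?D)" using H(1) unfolding D(2) by (auto simp: sym_def)
  moreover have "u \<in> pverts ?D" "v \<in> pverts ?D" using assms(3) H(3) D(1) by auto
  ultimately show "(u, v) \<in> (parcs ?D)\<^sup>*" by (rule connected_rtrancl_parcs)
  show "parcs ?D \<subseteq> parcs H" "(v, u) \<in> parcs H - (parcs ?D)\<inverse>" "u \<noteq> v"
    using D(2) assms(3) H(2) by (auto simp: irrefl_def)
qed

lemma pverts_subset_cycle_verts:
  assumes "pair_graph H" "two_edge_connected H"
  shows "pverts H \<subseteq> cycle_verts (parcs H)"
proof
  fix v assume v: "v \<in> pverts H"
  have "\<not> pverts H \<subseteq> {v}"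
    using assms(2) card_mono[of "{v}" "pverts H"] unfolding two_edge_connected_def by auto
  then obtain u where u: "u \<in> pverts H" "u \<noteq> v" by auto
  have "(v, u) \<in> (parcs H)\<^sup>*"
    using connected_rtrancl_parcs[OF _ pair_graphD(1)[OF assms(1)] v u(1)] assms(2)
    unfolding two_edge_connected_def by blast
  then obtain x where "(v, x) \<in> parcs H" using u(2) by (metis converse_rtranclE)
  then show "v \<in> cycle_verts (parcs H)"
    using edge_in_cycle_set[OF assms] unfolding cycle_verts_def by blast
qed

lemma n_M_le_card_cycle_verts:
  assumes "pair_graph G"
  shows "n_M G \<le> card (cycle_verts (parcs G))"
  unfolding n_M_def
proof (rule card_mono)
  note G = pair_graphD[OF assms]
  show "finite (cycle_verts (parcs G))"
    using cycle_verts_subset[OF G(3)] G(4) finite_subset by blast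
  have "pverts H \<subseteq> cycle_verts (parcs G)" if "max_two_edge_connected_component G H" for H
    using that pverts_subset_cycle_verts[of H] cycle_verts_mono[of "parcs H" "parcs G"]
    unfolding max_two_edge_connected_component_def subgraph_def by auto
  then show "(\<Union>H\<in>{H. max_two_edge_connected_component G H}. pverts H) \<subseteq> cycle_verts (parcs G)"
    by blast
qed

lemma pcas_map_upto:
  "a \<le> b \<Longrightarrow> pcas (z a) (map (\<lambda>i. (z i, z (i + 1))) [a..b - 1]) (z b)"
  by (induction a rule: int_le_induct) (simp_all add: upto_rec1)

lemma pawalk_verts_map_upto:
  "a \<le> b \<Longrightarrow> pawalk_verts (z a) (map (\<lambda>i. (z i, z (i + 1))) [a..b - 1]) = map z [a..b]"
  by (induction a rule: int_le_induct) (simp_all add: upto_rec1)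

lemma cycle_map_upto:
  assumes "cycle_walk (parcs G) m z" "range z \<subseteq> pverts G"
  shows "pre_digraph.cycle (with_proj G) (map (\<lambda>i. (z i, z (i + 1))) [0..m - 1])"
proof -
  let ?c = "map (\<lambda>i. (z i, z (i + 1))) [0..m - 1]"
  have m: "3 \<le> m" using cycle_walk_length[OF assms(1)] .
  have verts: "pawalk_verts (z 0) ?c = map z [0..m]"
    using pawalk_verts_map_upto[of 0 m z] m by simp
  have "pcas (z 0) ?c (z 0)"
    using pcas_map_upto[of 0 m z] cycle_walk_periodic[OF assms(1), of 0] m by simp
  moreover have "set ?c \<subseteq> parcs G" using cycle_walk_edge[OF assms(1)] by auto
  moreover have "z 0 \<in> pverts G" using assms(2) by blast
  moreover have "distinct (tl (map z [0..m]))"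
    using cycle_walk_inj_on[OF assms(1), of m 1] m by (simp add: upto_rec1[of 0 m] distinct_map)
  moreover have "?c \<noteq> []" using m by simp
  ultimately show ?thesis
    unfolding pre_digraph.cycle_def pre_digraph.awalk_def
    by (intro exI[of _ "z 0"]) (simp add: cas_with_proj_eq awalk_verts_with_proj_eq verts)
qed

lemma is_cycle_graph_if_cycle_rel:
  assumes "cycle_rel (pverts G) (parcs G)"
  shows "is_cycle_graph G"
proof -
  obtain m z where z: "cycle_walk (parcs G) m z" "pverts G = range z" "parcs G = cycle_edges z"
    using assms unfolding cycle_rel_def by blast
  let ?e = "\<lambda>i. (z i, z (i + 1))"
  let ?c = "map ?e [0..m - 1]"
  have "cycle_walk UNIV m ?e"
    using cycle_walk_length[OF z(1)] cycle_walk_eq_iff[OF z(1)] unfolding cycle_walk_def by simp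
  then have set_c: "set ?c = range ?e" using range_cycle_walk[of UNIV m ?e 0] by simp
  show ?thesis
    unfolding is_cycle_graph_def
  proof (intro exI conjI)
    show "pre_digraph.cycle (with_proj G) ?c" using cycle_map_upto[OF z(1)] z(2) by simp
    show "3 \<le> length ?c" using cycle_walk_length[OF z(1)] by simp
    show "pverts G = fst ` set ?c" unfolding set_c z(2) by (simp add: image_image)
    have "(range ?e)\<inverse> = range (\<lambda>i. (z (i + 1), z i))" by auto
    then show "parcs G = set ?c \<union> (set ?c)\<inverse>" unfolding set_c z(3) cycle_edges_def by simp
  qed
qed

lemma slide_pebble_move:
  assumes "configuration G p S" "slide {1..p} (parcs G) S S'" "parcs G \<subseteq> pverts G \<times> pverts G"
  shows "pebble_move G p S S'"
proof -
  obtain i v where i: "i \<in> {1..p}" "(S i, v) \<in> parcs G" "v \<notin> S ` {1..p}" "S' = S(i := v)"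
    using assms(2) by (rule slideE)
  have S: "S \<in> {1..p} \<rightarrow>\<^sub>E pverts G" "inj_on S {1..p}"
    using assms(1) unfolding configuration_def by simp_all
  have "v \<in> pverts G" using i(2) assms(3) by blast
  then have "S' \<in> {1..p} \<rightarrow>\<^sub>E pverts G"
    using PiE_fun_upd[OF _ S(1), of v i] i(1,4) by (simp add: insert_absorb)
  then have "configuration G p S'"
    using slide_inj_on[OF assms(2) S(2)] unfolding configuration_def by simp
  moreover have "S i \<noteq> v" using i(1,3) by auto
  then have "{j \<in> {1..p}. S j \<noteq> S' j} = {i}" using i(1,4) by auto
  moreover have "(S i, S' i) \<in> parcs G" using i(2,4) by simp
  ultimately show ?thesis using assms(1) unfolding pebble_move_def by blast
qed

lemma reaches_config_connected:
  assumes "configuration G p S" "reaches {1..p} (parcs G) S S'" "parcs G \<subseteq> pverts G \<times> pverts G"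
  shows "config_connected G p S S'"
proof -
  have "config_connected G p S S' \<and> configuration G p S'"
    using assms(2)
  proof (induction rule: reaches_induct)
    case (slide S1 S2)
    then have "pebble_move G p S1 S2" using slide_pebble_move assms(3) by blast
    moreover from this have "configuration G p S2" unfolding pebble_move_def by blast
    ultimately show ?case
      using slide(3) unfolding config_connected_def by (meson rtranclp.rtrancl_into_rtrancl)
  qed (use assms(1) in \<open>simp add: config_connected_def\<close>)
  then show ?thesis by blast
qed

theorem theorem5:
  fixes G :: "'a pair_pre_digraph" and p :: nat and S :: "nat \<Rightarrow> 'a" and \<pi> :: "nat \<Rightarrow> nat"
  assumes "pair_graph G"
    and "Digraph_Component.connected (with_proj G)"
    and "\<not> is_cycle_graph G"
    and "pebble_permutation_instance G p S \<pi>"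
    and "int p \<le> int (n_M G) - 3"
  shows "feasible G p S \<pi>"
proof -
  note G = pair_graphD[OF assms(1)]
  have S: "configuration G p S" and \<pi>: "\<pi> permutes {1..p}"
    using assms(4) unfolding pebble_permutation_instance_def by simp_all
  have inj: "inj_on S {1..p}" and into: "S ` {1..p} \<subseteq> pverts G" and ext: "S \<in> extensional {1..p}"
    using S unfolding configuration_def by (auto simp: PiE_def)
  have not_cycle: "\<not> cycle_rel (pverts G) (parcs G)"
    using is_cycle_graph_if_cycle_rel assms(3) by blast
  have "card {1..p} + 3 \<le> card (cycle_verts (parcs G))"
    using assms(5) n_M_le_card_cycle_verts[OF assms(1)] by simp
  then have "reaches {1..p} (parcs G) S (S \<circ> \<pi>)"
    by (rule reaches_permuted_if_not_cycle_rel[OF G connected_in_pverts[OF assms(1,2)] not_cycle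
          finite_atLeastAtMost _ inj into \<pi>])
  moreover have "S \<circ> \<pi> = (\<lambda>i\<in>{1..p}. S (\<pi> i))"
    using ext permutes_not_in[OF \<pi>] by (auto simp: fun_eq_iff extensional_def)
  ultimately show ?thesis
    unfolding feasible_def using reaches_config_connected[OF S _ G(3)] by simp
qed

end
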